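(* Let $\mathbb{F}_q$ be the finite field with $q$ elements, and let $k\ge 2$ be an integer with $k\mid q-1$. Let $f(x)=ax^2+bx+c\in\mathbb{F}_q[x]$ with $a\neq 0$ and $b^2-4ac\neq 0$. Suppose $q>\max\{e^{e^3},(2k)^6\}$. Then there is a primitive element $g$ of $\mathbb{F}_q$ such that $f(g)\in\mathbb{F}_q^{\times k}$.
   Context: A primitive element of $\mathbb{F}_q$ is a generator of the cyclic group $\mathbb{F}_q^{\times}=\mathbb{F}_q\setminus\{0\}$. For a positive integer $k$, $\mathbb{F}_q^{\times k}=\{x^k : x\in\mathbb{F}_q\setminus\{0\}\}$. *)

theory Defs
  imports
    Complex_Main
    "HOL-Computational_Algebra.Polynomial"
    "HOL-Library.Cardinality"
begin

(* Integer exponents, since g is to generate the nonzero elements as a group.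
   The equation excludes g = 0, because 0 powi 1 = 0. *)
definition primitive_element :: "'a :: {field, finite} \<Rightarrow> bool" where
  "primitive_element g \<longleftrightarrow> range (\<lambda>n :: int. g powi n) = UNIV - {0}"

definition nonzero_kth_powers :: "nat \<Rightarrow> 'a :: field set" where
  "nonzero_kth_powers k = {x ^ k | x. x \<in> UNIV - {0}}"

end

(*
For a divisor e of q - 1 let H_e be the group of e-th powers in F_q^*. If chi is a nontrivial
character of F_q^*, then e times the sum of chi(f(x)) over x in H_e is the sum of chi(f(u^e)) over
u <> 0, and Weil's bound for u |-> f(u^e), which has degree 2e and a simple root, makes the sum over
H_e at most 2 sqrt q. Averaging over the characters of order dividing k, the number of x in H_e with
f(x) a nonzero k-th power is (q - 1)/(e k) up to 2 sqrt q. A sieve over the primes p dividing q - 1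
removes the p-th powers and leaves the primitive elements; it suffices to sieve by 2 and 3
completely and to subtract the other primes one at a time, unless q - 1 has at least 12 prime
factors other than 2 and 3, when inclusion-exclusion over all primes is already good enough.

Weil's bound for sum chi(G(x)) is proved by Stepanov's method. The L-function of chi and G is a
polynomial of degree less than deg G, so the sums over F_{q^r} are minus power sums of its inverse
roots, and it is enough to bound the sums over F_{q^r}, for infinitely many r, by a constant times
q^{r/2}. For r = 2s put P = q^s. A pigeonhole argument yields a polynomial of low degree whose P-th
power agrees on the points with a given value of the norm of G with a polynomial that is
identically zero. Taking P-th powers replaces the vanishing to high order of Stepanov's argument,
so that no derivatives are needed.
*)
theory Submission
  imports
    "HOL-Algebra.Algebraic_Closure_Type"
    "HOL-Number_Theory.Cong"
    "HOL-Analysis.Kronecker_Approximation_Theorem"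
    Defs
begin

section \<open>The tower of finite fields inside an algebraic closure\<close>

text \<open>All that is asked of G is a simple root \<open>\<rho>\<close>, and it does two jobs. The
  resultant of G with a polynomial over F can be given a prescribed nonzero value, which makes the
  coefficients of the L-function vanish from degree deg G on; and the terms of Stepanov's auxiliary
  polynomial get different orders at \<open>\<rho>\<close>, so that it is not zero. Even degrees r =
  2s are convenient because, with P = q^s and w = (P - 1)/(q - 1), the norm is y^(w(P + 1)), and
  raising to the P-th power twice is the identity on the points: a P-th power turns X -
  \<open>\<rho>\<close> to the power kP into its k-th power. The method bounds the fibres of the
  norm only from above; since their total size is known, this controls the deficits as well. In the
  sieve, e^(e^3) enters only through q > 300000000, and (2k)^6 < q only through B^3 < q^2 for B = 2k
  sqrt q. The case of few primes needs 667 B < q - 1, and 667^3 is just below 300000000. With many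
  primes, q - 1 is at least their product, which outgrows the loss from inclusion-exclusion.\<close>

lemma simple_root_decomp:
  fixes p :: "'a :: idom poly"
  assumes "poly p x = 0" "poly (pderiv p) x \<noteq> 0"
  obtains g where "p = [:-x, 1:] * g" "poly g x \<noteq> 0"
proof -
  obtain g where g: "p = [:-x, 1:] * g" using assms(1) by (auto simp: poly_eq_0_iff_dvd)
  have "poly g x \<noteq> 0" using assms(2) unfolding g pderiv_mult by (simp add: pderiv_pCons)
  then show ?thesis using g that by blast
qed

lemma order_simple_root:
  fixes g :: "'a :: idom poly"
  assumes "poly g x \<noteq> 0"
  shows "order x ([:-x, 1:] * g) = 1"
proof -
  have "[:-x, 1:] * g \<noteq> 0" using assms by (metis mult_eq_0_iff pCons_eq_0_iff poly_0 one_neq_zero)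
  from order_mult[OF this, of x] show ?thesis
    using order_0I[OF assms] order_power_n_n[of x 1] by simp
qed

lemma proots_prod_linear: "proots (\<Prod>x\<in>#A. [:-x, 1:]) = (A :: 'a :: idom multiset)"
proof (induction A)
  case (add x A)
  have "(\<Prod>x\<in>#A. [:-x, 1:]) \<noteq> (0 :: 'a poly)" by (auto simp: prod_mset_zero_iff)
  then have "proots ([:-x, 1:] * (\<Prod>x\<in>#A. [:-x, 1:])) = {#x#} + A"
    by (subst proots_mult) (auto simp: add)
  then show ?case by simp
qed simp

text \<open>The fields with q^r elements are realized as fixed point sets of powers of Frobenius in
  one algebraically closed field, so that the points of every extension and all roots of polynomials
  share one type.\<close>

locale frobenius_tower =
  fixes q :: nat and F :: "'c :: alg_closed_field set"
  assumes prime_char: "prime CHAR('c)"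
    and q_eq_power: "\<exists>a>0. q = CHAR('c) ^ a"
    and F_eq: "F = {x. x ^ q = x}"
begin

text \<open>\<open>ext r\<close> is the field with \<open>q ^ r\<close> elements, and \<open>low_polys r d\<close> consists of the polynomials
  over it of degree less than \<open>d\<close>, including \<open>0\<close>.\<close>
definition ext :: "nat \<Rightarrow> 'c set" where "ext r = {x. x ^ (q ^ r) = x}"

definition polys :: "nat \<Rightarrow> 'c poly set" where
  "polys r = {h. \<forall>i. coeff h i \<in> ext r}"

definition low_polys :: "nat \<Rightarrow> nat \<Rightarrow> 'c poly set" where
  "low_polys r d = {h \<in> polys r. \<forall>i\<ge>d. coeff h i = 0}"

lemma ext_1: "ext 1 = F"
  by (simp add: ext_def F_eq)

lemma q_gt_1: "q > 1"
  using q_eq_power prime_char by (metis one_less_power prime_gt_1_nat)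

lemma q_power_pos [simp]: "q ^ r > 0"
  using q_gt_1 by simp

lemma of_nat_q_power: "r > 0 \<Longrightarrow> (of_nat (q ^ r) :: 'c) = 0"
  using q_eq_power of_nat_CHAR[where ?'a = 'c] by (auto simp: power_0_left)

lemma q_power_eq: "\<exists>b. q ^ r = CHAR('c) ^ b"
  using q_eq_power by (metis power_mult)

lemma frob_add: "(x + y :: 'c) ^ (q ^ r) = x ^ (q ^ r) + y ^ (q ^ r)"
  using q_power_eq[of r] freshmans_dream'[OF prime_char] by metis

lemma frob_uminus: "(- x :: 'c) ^ (q ^ r) = - (x ^ (q ^ r))"
  by (metis add.commute add.right_inverse eq_neg_iff_add_eq_0 frob_add power_0_left q_power_pos less_irrefl)

lemma frob_diff: "(x - y :: 'c) ^ (q ^ r) = x ^ (q ^ r) - y ^ (q ^ r)"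
  using frob_add[of x "- y" r] by (simp add: frob_uminus)

lemma frob_sum: "(sum f A :: 'c) ^ (q ^ r) = (\<Sum>i\<in>A. f i ^ (q ^ r))"
  using q_power_eq[of r] freshmans_dream_sum'[OF prime_char] by metis

lemma frob_inj: "(x :: 'c) ^ (q ^ r) = y ^ (q ^ r) \<longleftrightarrow> x = y"
  by (metis frob_diff eq_iff_diff_eq_0 power_eq_0_iff)

lemma poly_frob_add: "(x + y :: 'c poly) ^ (q ^ r) = x ^ (q ^ r) + y ^ (q ^ r)"
  using q_power_eq[of r] freshmans_dream'[where ?'a = "'c poly"] prime_char by (metis semiring_char_poly)

lemma poly_frob_diff: "(x - y :: 'c poly) ^ (q ^ r) = x ^ (q ^ r) - y ^ (q ^ r)"
  by (metis add_diff_cancel_right' diff_add_cancel poly_frob_add)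

lemma ext_0 [simp]: "0 \<in> ext r" and ext_one [simp]: "1 \<in> ext r"
  using q_gt_1 by (auto simp: ext_def power_0_left)

lemma ext_closed:
  assumes "x \<in> ext r" "y \<in> ext r"
  shows "x + y \<in> ext r" "x - y \<in> ext r" "- x \<in> ext r" "x * y \<in> ext r" "x ^ k \<in> ext r"
    "inverse x \<in> ext r"
proof -
  have "(x ^ k) ^ (q ^ r) = (x ^ (q ^ r)) ^ k" by (metis power_mult mult.commute)
  then show "x ^ k \<in> ext r" using assms by (simp add: ext_def)
  show "inverse x \<in> ext r" using assms by (simp add: ext_def power_inverse)
qed (use assms in \<open>auto simp: ext_def frob_add frob_diff frob_uminus power_mult_distrib\<close>)

lemma ext_sum: "(\<And>i. i \<in> A \<Longrightarrow> f i \<in> ext r) \<Longrightarrow> sum f A \<in> ext r"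
  by (induction A rule: infinite_finite_induct) (auto intro: ext_closed)

lemma ext_mult_subset: "ext r \<subseteq> ext (r * t)"
proof
  fix x assume x: "x \<in> ext r"
  have "x ^ (q ^ r) ^ t = x" by (induction t) (use x in \<open>auto simp: ext_def power_mult\<close>)
  then show "x \<in> ext (r * t)" by (simp add: ext_def power_mult)
qed

lemma ext_1_subset: "ext 1 \<subseteq> ext r"
  using ext_mult_subset[of 1 r] by simp

text \<open>X^Q - X has derivative -1 in this characteristic, so each of its Q roots is
  simple.\<close>

lemma ext_finite_card:
  assumes "r > 0"
  shows "finite (ext r)" "card (ext r) = q ^ r"
proof -
  define Q where "Q = q ^ r"
  have Q: "Q > 1" using assms q_gt_1 one_less_power unfolding Q_def by blast
  define p :: "'c poly" where "p = monom 1 Q - [:0, 1:]"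
  have [simp]: "coeff p Q = 1" using Q by (simp add: p_def coeff_pCons split: nat.splits)
  have dp: "degree p = Q"
  proof (rule antisym)
    show "degree p \<le> Q" unfolding p_def using Q
      by (intro degree_diff_le) (auto simp: degree_monom_eq)
    show "degree p \<ge> Q" by (rule le_degree) simp
  qed
  have p0: "p \<noteq> 0" using dp Q by auto
  have rt: "{x. poly p x = 0} = ext r" by (auto simp: p_def ext_def poly_monom Q_def)
  show "finite (ext r)" using poly_roots_finite[OF p0] rt by simp
  have "pderiv p = [:-1:]" using of_nat_q_power[OF assms]
    by (simp add: p_def pderiv_diff pderiv_monom pderiv_pCons Q_def power_0_left)
  then have ord: "order x p = 1" if "poly p x = 0" for x
    using that by (metis simple_root_decomp order_simple_root poly_const_conv[of "-1" x "-1"]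
        neg_equal_0_iff_equal one_neq_zero)
  obtain A where A: "size A = degree p" "p = smult (lead_coeff p) (\<Prod>x\<in>#A. [:-x, 1:])"
    using alg_closed_imp_factorization[OF p0] by blast
  have "proots p = proots (\<Prod>x\<in>#A. [:-x, 1:])" using A(2) p0
    by (metis proots_smult leading_coeff_0_iff)
  also have "\<dots> = A" by (rule proots_prod_linear)
  finally have szp: "size (proots p) = Q" using A dp by simp
  have "size (proots p) = (\<Sum>x\<in>set_mset (proots p). count (proots p) x)"
    by (rule size_multiset_overloaded_eq)
  also have "\<dots> = (\<Sum>x\<in>ext r. 1)"
    using p0 ord rt[symmetric] by (intro sum.cong) auto
  finally show "card (ext r) = q ^ r" using szp Q_def by simp
qed

section \<open>Polynomials with coefficients in a field of the tower\<close>

lemma polys_closed: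
  assumes "g \<in> polys r" "h \<in> polys r"
  shows "g + h \<in> polys r" "g - h \<in> polys r" "- g \<in> polys r" "g * h \<in> polys r"
  using assms by (auto simp: polys_def coeff_mult intro!: ext_closed ext_sum)

lemma polys_const [simp]: "[:a:] \<in> polys r \<longleftrightarrow> a \<in> ext r"
  by (auto simp: polys_def coeff_pCons split: nat.splits)

lemma polys_pCons [simp]: "pCons a h \<in> polys r \<longleftrightarrow> a \<in> ext r \<and> h \<in> polys r"
  by (auto simp: polys_def coeff_pCons split: nat.splits)

lemma polys_0 [simp]: "0 \<in> polys r" and polys_1 [simp]: "1 \<in> polys r"
  by (auto simp: polys_def one_pCons coeff_pCons split: nat.splits)

lemma polys_power: "h \<in> polys r \<Longrightarrow> h ^ k \<in> polys r"
  by (induction k) (auto intro: polys_closed)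

lemma polys_sum: "(\<And>i. i \<in> A \<Longrightarrow> f i \<in> polys r) \<Longrightarrow> sum f A \<in> polys r"
  by (induction A rule: infinite_finite_induct) (auto intro: polys_closed)

lemma polys_1_subset: "polys 1 \<subseteq> polys r"
  using ext_1_subset[of r] by (auto simp: polys_def)

lemma poly_frob:
  assumes "h \<in> polys r"
  shows "poly h x ^ (q ^ r) = poly h (x ^ (q ^ r))"
  using assms
proof (induction h)
  case (pCons a h)
  then have "a \<in> ext r" "h \<in> polys r" by auto
  with pCons show ?case by (simp add: frob_add power_mult_distrib ext_def)
qed (use q_gt_1 in \<open>simp add: power_0_left\<close>)

lemma poly_in_ext: "h \<in> polys r \<Longrightarrow> x \<in> ext r \<Longrightarrow> poly h x \<in> ext r"
  using poly_frob[of h r x] by (simp add: ext_def)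

lemma low_polys_Suc: "low_polys r (Suc d) = (\<lambda>(a, h). pCons a h) ` (ext r \<times> low_polys r d)"
proof safe
  fix h assume h: "h \<in> low_polys r (Suc d)"
  obtain a g where ag: "h = pCons a g" by (cases h)
  have "coeff g i = 0" if "i \<ge> d" for i
    using h that ag by (auto simp: low_polys_def dest!: spec[of _ "Suc i"])
  then have "g \<in> low_polys r d" "a \<in> ext r" using h ag by (auto simp: low_polys_def)
  then show "h \<in> (\<lambda>(a, h). pCons a h) ` (ext r \<times> low_polys r d)" using ag by auto
next
  fix a h assume "a \<in> ext r" "h \<in> low_polys r d"
  then show "pCons a h \<in> low_polys r (Suc d)"
    by (auto simp: low_polys_def coeff_pCons split: nat.splits)
qed

lemma low_polys_finite_card:
  assumes "r > 0"
  shows "finite (low_polys r d) \<and> card (low_polys r d) = q ^ (r * d)"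
proof (induction d)
  case 0
  have "low_polys r 0 = {0}" by (auto simp: low_polys_def poly_eq_iff)
  then show ?case by simp
next
  case (Suc d)
  have "inj_on (\<lambda>(a, h). pCons a h) (ext r \<times> low_polys r d)" by (auto simp: inj_on_def)
  then show ?case
    using Suc ext_finite_card[OF assms]
    by (simp add: low_polys_Suc card_image card_cartesian_product power_add)
qed

lemma low_polys_diff: "g \<in> low_polys r d \<Longrightarrow> h \<in> low_polys r d \<Longrightarrow> g - h \<in> low_polys r d"
  by (auto simp: low_polys_def intro: polys_closed)

lemma low_polys_degree: "h \<in> low_polys r d \<Longrightarrow> h \<noteq> 0 \<Longrightarrow> degree h < d"
  by (auto simp: low_polys_def) (metis leading_coeff_0_iff not_less)

lemma low_polysI: "h \<in> polys r \<Longrightarrow> h = 0 \<or> degree h < d \<Longrightarrow> h \<in> low_polys r d"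
  by (auto simp: low_polys_def intro: coeff_eq_0)

end

section \<open>Stepanov's method\<close>

context frobenius_tower
begin

text \<open>The summands have pairwise distinct orders at \<open>\<rho>\<close>, because \<open>G\<close> vanishes there to order
  exactly 1.\<close>
lemma low_order_sum_nonzero:
  fixes G :: "'c poly" and u :: "nat \<times> nat \<Rightarrow> 'c poly"
  assumes G: "G = [:-\<rho>, 1:] * G1" "poly G1 \<rho> \<noteq> 0"
    and P: "P = n * w + 1"
    and low: "\<And>j k. j < n \<Longrightarrow> k < K \<Longrightarrow> u (j, k) = 0 \<or> degree (u (j, k)) < w"
    and nz: "j1 < n" "k1 < K" "u (j1, k1) \<noteq> 0"
  shows "(\<Sum>(j,k)\<in>{..<n}\<times>{..<K}. u (j, k) * G ^ (j * w) * [:-\<rho>, 1:] ^ (k * P)) \<noteq> 0"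
proof
  define L where "L = [:-\<rho>, 1:]"
  define tm where "tm = (\<lambda>(j,k). u (j, k) * G ^ (j * w) * L ^ (k * P))"
  assume "(\<Sum>(j,k)\<in>{..<n}\<times>{..<K}. u (j, k) * G ^ (j * w) * [:-\<rho>, 1:] ^ (k * P)) = 0"
  then have sum0: "sum tm ({..<n}\<times>{..<K}) = 0" by (simp add: tm_def L_def)
  define S where "S = {(j, k). j < n \<and> k < K \<and> u (j, k) \<noteq> 0}"
  \<comment> \<open>\<open>e (j, k)\<close> is the order of \<open>G ^ (j * w) * L ^ (k * P)\<close>
    at \<open>\<rho>\<close>. As P = n * w + 1, these values are at least w apart, while a nonzero
    \<open>u (j, k)\<close> adds an order less than w.\<close>
  define e where "e = (\<lambda>(j, k). j * w + k * P)"
  have finS: "finite S" by (rule finite_subset[of _ "{..<n}\<times>{..<K}"]) (auto simp: S_def)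
  have "S \<noteq> {}" using nz by (auto simp: S_def)
  then obtain z where z: "z \<in> S" "\<And>y. y \<in> S \<Longrightarrow> e z \<le> e y"
    using finS by (metis arg_min_if_finite(1) arg_min_least)
  obtain j0 k0 where z_eq: "z = (j0, k0)" by (cases z)
  have jk: "j0 < n" "k0 < K" "u (j0, k0) \<noteq> 0" using z by (auto simp: S_def z_eq)
  have other: "e (j, k) \<ge> e z + w" if "(j, k) \<in> S" "(j, k) \<noteq> z" for j k
  proof -
    have j: "j < n" using that by (auto simp: S_def)
    have le: "e z \<le> e (j, k)" using z that by auto
    have jw: "j * w + w \<le> n * w" "j0 * w + w \<le> n * w"
      using j jk by (metis Suc_leI add.commute mult_Suc mult_le_mono1)+
    consider "k = k0" | "k > k0" | "k < k0" by linarith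
    then show ?thesis
    proof cases
      case 1
      then have "j \<noteq> j0" using that by (auto simp: z_eq)
      \<comment> \<open>\<open>low\<close> gives w > 0 here, so a smaller j would contradict the
        minimality of \<open>e z\<close>.\<close>
      moreover have "\<not> j < j0" using le 1 P low[OF jk(1,2)] jk
        by (auto simp: e_def z_eq)
      ultimately have "Suc j0 \<le> j" by auto
      then have "Suc j0 * w \<le> j * w" by (rule mult_le_mono1)
      then show ?thesis using 1 by (simp add: e_def z_eq)
    next
      case 2
      then have "Suc k0 * P \<le> k * P" by (intro mult_le_mono1) auto
      then show ?thesis using jw P by (simp add: e_def z_eq)
    next
      case 3
      then have "Suc k * P \<le> k0 * P" by (intro mult_le_mono1) auto
      then show ?thesis using jw P le by (simp add: e_def z_eq)
    qed
  qed
  have tm_dvd: "L ^ (e z + w) dvd tm y" if "y \<in> {..<n}\<times>{..<K} - {z}" for y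
  proof -
    obtain j k where y: "y = (j, k)" by (cases y)
    show ?thesis
    proof (cases "u (j, k) = 0")
      case False
      then have "e z + w \<le> e (j, k)" using that y by (intro other) (auto simp: S_def)
      then have "L ^ (e z + w) dvd L ^ (e (j, k))" by (rule le_imp_power_dvd)
      also have "L ^ (e (j, k)) dvd tm y"
      proof -
        have "tm y = L ^ (e (j, k)) * (u (j, k) * G1 ^ (j * w))"
          by (simp add: y tm_def e_def G(1) power_mult_distrib power_add L_def[symmetric] mult_ac)
        then show ?thesis by (metis dvd_triv_left)
      qed
      finally show ?thesis .
    qed (simp add: y tm_def)
  qed
  have "tm z = - sum tm ({..<n}\<times>{..<K} - {z})"
    using sum0 jk by (subst (asm) sum.remove[of _ z]) (auto simp: z_eq eq_neg_iff_add_eq_0)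
  also have "L ^ (e z + w) dvd \<dots>" unfolding dvd_minus_iff by (intro dvd_sum tm_dvd)
  finally have "L ^ (e z + w) dvd tm z" .
  moreover have "tm z = L ^ e z * (u (j0, k0) * G1 ^ (j0 * w))"
    by (simp add: z_eq tm_def e_def G(1) power_mult_distrib power_add L_def[symmetric] mult_ac)
  ultimately have "L ^ w dvd u (j0, k0) * G1 ^ (j0 * w)"
    by (simp add: power_add L_def)
  moreover have nz2: "u (j0, k0) * G1 ^ (j0 * w) \<noteq> 0" using jk G(2) by auto
  ultimately have "w \<le> order \<rho> (u (j0, k0) * G1 ^ (j0 * w))"
    unfolding L_def order_divides by blast
  also have "\<dots> = order \<rho> (u (j0, k0))"
  proof -
    have "order \<rho> (G1 ^ (j0 * w)) = 0" using G(2) by (intro order_0I) auto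
    then show ?thesis unfolding order_mult[OF nz2] by simp
  qed
  also have "\<dots> \<le> degree (u (j0, k0))" using jk by (intro order_degree)
  also have "\<dots> < w" using low[OF jk(1,2)] jk by auto
  finally show False by simp
qed

text \<open>Stepanov's bound. The term \<open>w * (P + 1)\<close> is (P^2 - 1)/(q - 1), the average
  size of a fibre of the norm on the nonzero elements, so the excess is of order P only. On the
  fibre, the exponent j w P + n w = j w (P + 1) + (n - j) w lets a power of G be traded for
  \<open>\<alpha> ^ j\<close>.\<close>

lemma card_norm_fibre_le:
  fixes G :: "'c poly"
  assumes GF: "G \<in> polys 1" and m: "m = degree G"
    and G: "G = [:-\<rho>, 1:] * G1" "poly G1 \<rho> \<noteq> 0"
    and s: "s > 0" and rho: "\<rho> \<in> ext s"
    and P: "P = q ^ s" "P = (q - 1) * w + 1"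
    and large: "P > 2 * m + 4"
    and \<alpha>: "\<alpha> \<in> ext (2 * s)" "\<alpha> \<noteq> 0"
  shows "card {x \<in> ext (2 * s). poly G x ^ (w * (P + 1)) = \<alpha>} \<le> w * (P + 1) + (2 * m + 3) * P"
proof -
  \<comment> \<open>\<open>K\<close> makes the number w n K = (P - 1) K of free coefficients exceed
    the number D of coefficients to be killed: the difference is 3 P - 2 w - 2 m - 6, which is
    positive because w < P and P > 2 m + 4.\<close>
  define n K where "n = q - 1" and "K = w + m + 3"
  define R where "R = 2 * s"
  have n: "n > 0" using q_gt_1 by (simp add: n_def)
  have Pn: "P = n * w + 1" using P n_def by simp
  have w0: "w > 0" using large Pn by (cases w) auto
  have qR: "q ^ R = P * P" by (simp add: R_def P(1) power2_eq_square flip: power_add mult_2)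
  have R0: "R > 0" using s by (simp add: R_def)
  have G0: "G \<noteq> 0" using G by (metis mult_eq_0_iff pCons_eq_0_iff poly_0 one_neq_zero)
  have rhoR: "\<rho> \<in> ext R" using rho ext_mult_subset[of s 2] by (auto simp: R_def mult.commute)
  have GR: "G \<in> polys R" using GF polys_1_subset by blast
  define L where "L = [:-\<rho>, 1:]"
  have LR: "L \<in> polys R" using rhoR by (auto simp: L_def intro: ext_closed)
  define D where "D = P * w + m * P + K"
  \<comment> \<open>\<open>Z u\<close> is what \<open>T u ^ P * G ^ (n * w)\<close> becomes at the
    points of the fibre. The P-th powers leave it additive in \<open>u\<close> but not linear, so
    the pigeonhole argument counts tuples instead of comparing dimensions.\<close>
  define Z where "Z = (\<lambda>u. \<Sum>(j,k)\<in>{..<n}\<times>{..<K}. u (j, k) ^ P * [:\<alpha> ^ j:] * G ^ ((n - j) * w) * L ^ k)"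
  define T where "T = (\<lambda>u. \<Sum>(j,k)\<in>{..<n}\<times>{..<K}. u (j, k) * G ^ (j * w) * L ^ (k * P))"
  define U where "U = PiE ({..<n}\<times>{..<K}) (\<lambda>_. low_polys R w)"
  have fin: "finite (low_polys R d)" and crd: "card (low_polys R d) = (q ^ R) ^ d" for d
    using low_polys_finite_card[OF R0] by (auto simp: power_mult)
  have cardU: "card U = (q ^ R) ^ (w * (n * K))"
    unfolding U_def by (subst card_PiE) (auto simp: crd power_mult)
  have finU: "finite U" unfolding U_def by (intro finite_PiE) (auto simp: fin)
  have Uin: "u (j, k) \<in> low_polys R w" if "u \<in> U" "j < n" "k < K" for u j k
    using that unfolding U_def by (auto simp: PiE_def Pi_def)
  have ZU: "Z u \<in> low_polys R D" if "u \<in> U" for u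
  proof (rule low_polysI)
    show "Z u \<in> polys R" unfolding Z_def
    proof (rule polys_sum)
      fix z assume "z \<in> {..<n} \<times> {..<K}"
      then obtain j k where z: "z = (j, k)" and "j < n" "k < K" by auto
      then have "u (j, k) \<in> polys R" using Uin[OF that] by (auto simp: low_polys_def)
      then have "u (j, k) ^ P * [:\<alpha> ^ j:] * G ^ ((n - j) * w) * L ^ k \<in> polys R"
        using \<alpha> LR GR by (intro polys_closed polys_power) (auto simp: R_def intro!: ext_closed)
      then show "(case z of (j, k) \<Rightarrow> u (j, k) ^ P * [:\<alpha> ^ j:] * G ^ ((n - j) * w) * L ^ k) \<in> polys R"
        by (simp add: z)
    qed
    have "degree (Z u) \<le> D - 1" unfolding Z_def
    proof (rule degree_sum_le, simp)
      fix z assume "z \<in> {..<n} \<times> {..<K}"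
      then obtain j k where z: "z = (j, k)" and jk: "j < n" "k < K" by auto
      have "degree (smult (\<alpha> ^ j) (u (j, k) ^ P) * G ^ ((n - j) * w) * L ^ k) \<le> D - 1"
      proof (cases "u (j, k) = 0")
        case False
        then have d: "degree (u (j, k)) < w" using Uin[OF that jk] low_polys_degree by blast
        have "degree (smult (\<alpha> ^ j) (u (j, k) ^ P) * G ^ ((n - j) * w) * L ^ k)
          = P * degree (u (j, k)) + (n - j) * w * m + k"
          using False G0 \<alpha> by (simp add: degree_mult_eq degree_power_eq m L_def degree_linear_power)
        also have "\<dots> \<le> P * w + n * w * m + (K - 1)"
          using d jk by (intro add_mono mult_mono) auto
        also have "\<dots> \<le> D - 1" using Pn jk by (simp add: D_def algebra_simps)
        finally show ?thesis .
      qed (use Pn in simp)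
      then show "degree (case z of (j, k) \<Rightarrow> u (j, k) ^ P * [:\<alpha> ^ j:] * G ^ ((n - j) * w) * L ^ k) \<le> D - 1"
        by (simp add: z)
    qed
    then show "Z u = 0 \<or> degree (Z u) < D" by (auto simp: D_def K_def)
  qed
  have "D < w * (n * K)"
  proof -
    have "w * n = P - 1" using Pn by (simp add: mult.commute)
    then have "w * (n * K) = (P - 1) * K" by (simp add: mult.assoc[symmetric])
    moreover obtain p where p: "P = p + 2" using that[of "P - 2"] large by simp
    have wp: "w \<le> p + 1" using Pn n p by (cases n) auto
    have "w * 2 + m * 2 < 3 * p" using wp large p by (simp)
    ultimately show ?thesis unfolding D_def K_def p
      by (simp add: algebra_simps)
  qed
  then have "card (Z ` U) < card U"
    using card_mono[OF fin[of D], of "Z ` U"] ZU q_gt_1 R0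
    by (auto simp: cardU crd intro!: le_less_trans[OF _ power_strict_increasing] one_less_power)
  then obtain u1 u2 where u12: "u1 \<in> U" "u2 \<in> U" "u1 \<noteq> u2" "Z u1 = Z u2"
    using pigeonhole[of Z U] by (auto simp: inj_on_def)
  define u where "u = (\<lambda>z. u1 z - u2 z)"
  obtain j1 k1 where jk1: "j1 < n" "k1 < K" "u (j1, k1) \<noteq> 0"
  proof -
    have "\<exists>z \<in> {..<n}\<times>{..<K}. u1 z \<noteq> u2 z"
      using u12 unfolding U_def by (metis PiE_ext)
    then show ?thesis using that by (auto simp: u_def)
  qed
  have ulow: "u (j, k) \<in> low_polys R w" if "j < n" "k < K" for j k
    using that u12 Uin unfolding u_def by (intro low_polys_diff) auto
  have Zu: "Z u = 0"
  proof -
    have "Z u = Z u1 - Z u2"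
      unfolding Z_def u_def P(1) poly_frob_diff
      by (simp add: case_prod_unfold sum_subtractf[symmetric] algebra_simps smult_diff_right)
    then show ?thesis using u12 by simp
  qed
  have Tu: "T u \<noteq> 0" unfolding T_def L_def
    by (rule low_order_sum_nonzero[where u = u and ?j1.0 = j1 and ?k1.0 = k1, OF G Pn])
      (use ulow low_polys_degree jk1 in blast)+
  have root: "poly (T u) x = 0" if x: "x \<in> ext R" "poly G x ^ (w * (P + 1)) = \<alpha>" for x
  proof -
    have gx: "poly G x \<noteq> 0" using x \<alpha> w0 by (auto simp: power_0_left)
    have xL: "poly L x ^ (P * P) = poly L x"
      using poly_in_ext[OF LR x(1)] unfolding ext_def qR by simp
    have "poly (T u) x ^ P * poly G x ^ (n * w) = poly (Z u) x"
      unfolding T_def Z_def poly_sum sum_distrib_right P(1) frob_sum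
    proof (rule sum.cong, simp, fold P(1))
      fix z assume "z \<in> {..<n} \<times> {..<K}"
      then obtain j k where z: "z = (j, k)" and jk: "j < n" "k < K" by auto
      define g l v where "g = poly G x" and "l = poly L x" and "v = poly (u (j, k)) x"
      have "(g ^ (j * w)) ^ P * g ^ (n * w) = (g ^ (w * (P + 1))) ^ j * g ^ ((n - j) * w)"
      proof -
        obtain i where i: "n = j + i" using jk by (metis less_imp_add_positive)
        show ?thesis by (simp add: i flip: power_mult power_add) (simp add: algebra_simps)
      qed
      then have 1: "(g ^ (j * w)) ^ P * g ^ (n * w) = \<alpha> ^ j * g ^ ((n - j) * w)"
        using x g_def by simp
      have 2: "(l ^ (k * P)) ^ P = l ^ k"
        using xL unfolding l_def by (metis power_mult mult.assoc mult.commute)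
      have "(v * g ^ (j * w) * l ^ (k * P)) ^ P * g ^ (n * w)
          = v ^ P * ((g ^ (j * w)) ^ P * g ^ (n * w)) * (l ^ (k * P)) ^ P"
        by (simp add: power_mult_distrib mult_ac)
      also have "\<dots> = \<alpha> ^ j * v ^ P * g ^ ((n - j) * w) * l ^ k"
        unfolding 1 2 by (simp add: mult_ac)
      finally show "poly (case z of (j, k) \<Rightarrow> u (j, k) * G ^ (j * w) * L ^ (k * P)) x ^ P * poly G x ^ (n * w)
          = poly (case z of (j, k) \<Rightarrow> u (j, k) ^ P * [:\<alpha> ^ j:] * G ^ ((n - j) * w) * L ^ k) x"
        by (simp add: z g_def l_def v_def)
    qed
    then show ?thesis using Zu gx by simp
  qed
  have "card {x \<in> ext (2 * s). poly G x ^ (w * (P + 1)) = \<alpha>} \<le> card {x. poly (T u) x = 0}"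
    using root poly_roots_finite[OF Tu] by (intro card_mono) (auto simp: R_def)
  also have "\<dots> \<le> degree (T u)" using Tu by (rule card_poly_roots_bound)
  also have "\<dots> \<le> w + m * P + K * P - P" unfolding T_def
  proof (rule degree_sum_le, simp)
    fix z assume "z \<in> {..<n} \<times> {..<K}"
    then obtain j k where z: "z = (j, k)" and jk: "j < n" "k < K" by auto
    have "degree (u (j, k) * G ^ (j * w) * L ^ (k * P)) \<le> w + m * P + K * P - P"
    proof (cases "u (j, k) = 0")
      case False
      then have d: "degree (u (j, k)) < w" using ulow[OF jk] low_polys_degree by blast
      have "degree (u (j, k) * G ^ (j * w) * L ^ (k * P)) = degree (u (j, k)) + j * w * m + k * P"
        using False G0 by (simp add: degree_mult_eq degree_power_eq m L_def degree_linear_power)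
      also have "\<dots> \<le> w + n * w * m + (K - 1) * P"
        using d jk by (intro add_mono mult_mono) auto
      also have "\<dots> \<le> w + m * P + (K - 1) * P" using Pn by simp
      also have "\<dots> = w + m * P + K * P - P"
      proof -
        have "K * P = (K - 1) * P + P" by (simp add: K_def algebra_simps)
        then show ?thesis by simp
      qed
      finally show ?thesis .
    qed simp
    then show "degree (case z of (j, k) \<Rightarrow> u (j, k) * G ^ (j * w) * L ^ (k * P)) \<le> w + m * P + K * P - P"
      by (simp add: z)
  qed
  also have "\<dots> \<le> w * (P + 1) + (2 * m + 3) * P"
    by (simp add: K_def algebra_simps)
  finally show ?thesis .
qed

end

section \<open>Frobenius orbits and factorizations of monic polynomials\<close>

lemma prod_lessThan_add:
  fixes f :: "nat \<Rightarrow> 'a :: comm_monoid_mult"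
  shows "prod f {..<a + b} = prod f {..<a} * (\<Prod>i<b. f (a + i))"
  by (induction b) (auto simp: mult_ac)

lemma proots_factorization:
  fixes p :: "'a :: alg_closed_field poly"
  assumes "p \<noteq> 0"
  shows "p = smult (lead_coeff p) (\<Prod>x\<in>#proots p. [:-x, 1:])"
    and "size (proots p) = degree p"
proof -
  obtain A where A: "size A = degree p" "p = smult (lead_coeff p) (\<Prod>x\<in>#A. [:-x, 1:])"
    using alg_closed_imp_factorization[OF assms] by blast
  have "proots p = proots (\<Prod>x\<in>#A. [:-x, 1:])" using A(2) assms
    by (metis proots_smult leading_coeff_0_iff)
  also have "\<dots> = A" by (rule proots_prod_linear)
  finally show "p = smult (lead_coeff p) (\<Prod>x\<in>#proots p. [:-x, 1:])"
    "size (proots p) = degree p" using A by auto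
qed

lemma dvd_if_order_le:
  fixes p h :: "'a :: alg_closed_field poly"
  assumes "p \<noteq> 0" "h \<noteq> 0" "\<And>x. order x p \<le> order x h"
  shows "p dvd h"
proof -
  have "proots p \<subseteq># proots h" using assms by (intro mset_subset_eqI) auto
  then obtain B where B: "proots h = proots p + B" by (metis mset_subset_eq_exists_conv)
  have "(\<Prod>x\<in>#proots p. [:-x, 1:]) dvd h"
    by (subst proots_factorization(1)[OF assms(2)]) (simp add: B dvd_smult)
  then show ?thesis
    by (subst proots_factorization(1)[OF assms(1)]) (simp add: smult_dvd assms(1))
qed

lemma lagrange_interpolation:
  fixes y :: "'a :: field \<Rightarrow> 'a"
  assumes "finite R"
  shows "\<exists>h. degree h \<le> card R - 1 \<and> (\<forall>x\<in>R. poly h x = y x)"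
  using assms
proof (induction R)
  case empty
  show ?case by (intro exI[of _ 0]) auto
next
  case (insert a R)
  then obtain h where h: "degree h \<le> card R - 1" "\<forall>x\<in>R. poly h x = y x" by blast
  define g where "g = (\<Prod>s\<in>R. [:-s, 1:])"
  have ga: "poly g a \<noteq> 0" using insert by (auto simp: g_def poly_prod)
  have gR: "poly g x = 0" if "x \<in> R" for x using insert that by (auto simp: g_def poly_prod)
  have dg: "degree g = card R" unfolding g_def by (subst degree_prod_eq_sum_degree) auto
  define h' where "h' = h + smult ((y a - poly h a) / poly g a) g"
  have "degree h' \<le> card R" unfolding h'_def using h dg
    by (intro degree_add_le) (auto intro: order_trans[OF degree_smult_le])
  moreover have "\<forall>x\<in>insert a R. poly h' x = y x"
    using h ga gR by (auto simp: h'_def)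
  ultimately show ?case using insert by (intro exI[of _ h']) auto
qed

lemma count_image_mset_inj: "inj f \<Longrightarrow> count (image_mset f A) (f x) = count A x"
  by (induction A) (auto simp: inj_eq)

context frobenius_tower
begin

section \<open>Frobenius acting on coefficients and roots\<close>

definition frob_poly :: "'c poly \<Rightarrow> 'c poly" where "frob_poly = map_poly (\<lambda>a. a ^ q)"

lemma coeff_frob_poly [simp]: "coeff (frob_poly h) i = coeff h i ^ q"
  using q_gt_1 by (simp add: frob_poly_def coeff_map_poly)

lemma in_polys_1_iff: "h \<in> polys 1 \<longleftrightarrow> frob_poly h = h"
  by (auto simp: polys_def ext_def poly_eq_iff)

lemma poly_frob_poly: "poly (frob_poly h) (x ^ q) = poly h x ^ q"
proof (induction h)
  case (pCons a h)
  have "frob_poly (pCons a h) = pCons (a ^ q) (frob_poly h)"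
    by (auto simp: poly_eq_iff coeff_pCons split: nat.splits)
  then show ?case using pCons frob_add[of a "x * poly h x" 1] by (simp add: power_mult_distrib)
qed (use q_gt_1 in \<open>simp add: frob_poly_def power_0_left\<close>)

lemma frob_poly_mult: "frob_poly (g * h) = frob_poly g * frob_poly h"
  by (simp add: poly_eq_iff coeff_mult power_mult_distrib frob_sum[where r = 1, unfolded power_one_right])

lemma frob_poly_add: "frob_poly (g + h) = frob_poly g + frob_poly h"
  using frob_add[where r = 1] by (auto simp: poly_eq_iff)

lemma frob_poly_power: "frob_poly (g ^ n) = frob_poly g ^ n"
proof (induction n)
  case 0
  have "frob_poly 1 = 1" using q_gt_1 by (auto simp: poly_eq_iff power_0_left)
  then show ?case by simp
qed (simp add: frob_poly_mult)

lemma frob_poly_linear: "frob_poly [:-x, 1:] = [:-(x ^ q), 1:]"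
  using q_gt_1 frob_uminus[where r = 1]
  by (auto simp: poly_eq_iff coeff_pCons power_0_left split: nat.splits)

text \<open>Frobenius fixes the coefficients of \<open>h\<close>, so it carries the factorization at
  \<open>x\<close> to one at \<open>x ^ q\<close>.\<close>

lemma order_frob:
  assumes "h \<in> polys 1" "h \<noteq> 0"
  shows "order (x ^ q) h = order x h"
proof -
  note False = assms(2)
  obtain g where g: "h = [:-x, 1:] ^ order x h * g" "\<not> [:-x, 1:] dvd g"
    using order_decomp[OF False] by metis
  have gx: "poly g x \<noteq> 0" using g(2) by (simp add: poly_eq_0_iff_dvd)
  have "h = [:-(x ^ q), 1:] ^ order x h * frob_poly g"
    using assms(1) g(1) by (metis in_polys_1_iff frob_poly_mult frob_poly_power frob_poly_linear)
  moreover have "poly (frob_poly g) (x ^ q) \<noteq> 0" using gx by (simp add: poly_frob_poly)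
  then have "order (x ^ q) (frob_poly g) = 0" by (rule order_0I)
  ultimately show ?thesis
    using False order_power_n_n[of "x ^ q" "order x h"] order_mult by (metis add.right_neutral)
qed

lemma frob_iter_Suc: "(x ^ (q ^ i)) ^ q = x ^ (q ^ Suc i)" for x :: 'c
  by (metis power_mult power_Suc2)

lemma order_frob_iter: "h \<in> polys 1 \<Longrightarrow> h \<noteq> 0 \<Longrightarrow> order (x ^ (q ^ i)) h = order x h"
proof (induction i)
  case (Suc i)
  then show ?case using order_frob[of h "x ^ (q ^ i)"] unfolding frob_iter_Suc by simp
qed simp

lemma frob_bij: "bij (\<lambda>x :: 'c. x ^ q)"
proof (rule bijI)
  show "inj (\<lambda>x :: 'c. x ^ q)" using frob_inj[where r = 1] by (simp add: inj_def)
  show "surj (\<lambda>x :: 'c. x ^ q)"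
    unfolding surj_def using q_gt_1 nth_root_exists[of q] by (metis gr_zeroI not_one_less_zero)
qed

lemma image_mset_frob_proots:
  assumes "h \<in> polys 1"
  shows "image_mset (\<lambda>x. x ^ q) (proots h) = proots h"
proof (cases "h = 0")
  case False
  show ?thesis
  proof (rule multiset_eqI)
    fix y :: 'c
    obtain x where y: "y = x ^ q" using frob_bij by (metis bij_pointE)
    have "count (image_mset (\<lambda>x. x ^ q) (proots h)) (x ^ q) = count (proots h) x"
      using frob_bij by (intro count_image_mset_inj[OF bij_is_inj])
    then show "count (image_mset (\<lambda>x. x ^ q) (proots h)) y = count (proots h) y"
      using False by (simp add: y order_frob[OF assms False])
  qed
qed simp

text \<open>For x in \<open>ext r\<close> this is the characteristic polynomial of x over F, that
  is, the minimal polynomial to the power r / e, where e is the degree of x.\<close>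

definition orbit_poly :: "nat \<Rightarrow> 'c \<Rightarrow> 'c poly" where
  "orbit_poly r x = (\<Prod>i<r. [:-(x ^ (q ^ i)), 1:])"

definition monics :: "nat \<Rightarrow> 'c poly set" where
  "monics d = {h \<in> polys 1. degree h = d \<and> lead_coeff h = 1}"

lemma monics_finite: "finite (monics d)"
proof (rule finite_subset)
  show "monics d \<subseteq> low_polys 1 (Suc d)"
    unfolding monics_def by (intro subsetI low_polysI) auto
qed (use low_polys_finite_card[of 1] in auto)

lemma orbit_poly_nonzero [simp]: "orbit_poly r x \<noteq> 0"
  by (auto simp: orbit_poly_def)

lemma orbit_poly_monic: "degree (orbit_poly r x) = r" "lead_coeff (orbit_poly r x) = 1"
proof -
  show "degree (orbit_poly r x) = r"
    by (auto simp: orbit_poly_def degree_prod_eq_sum_degree)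
  have "lead_coeff (orbit_poly r x) = (\<Prod>i<r. lead_coeff [:-(x ^ (q ^ i)), 1:])"
    unfolding orbit_poly_def by (rule lead_coeff_prod)
  then show "lead_coeff (orbit_poly r x) = 1" by simp
qed

text \<open>Frobenius shifts the linear factors cyclically, because the last one is followed by the
  first. Multiplying by \<open>f 0\<close> expresses both sides through the same r + 1 consecutive
  factors.\<close>

lemma orbit_poly_in_polys:
  assumes "x \<in> ext r"
  shows "orbit_poly r x \<in> polys 1"
proof -
  define f where "f = (\<lambda>i. [:-(x ^ (q ^ i)), 1:])"
  have fr: "f r = f 0" using assms by (simp add: f_def ext_def)
  have "frob_poly (\<Prod>i\<in>A. f i) = (\<Prod>i\<in>A. f (Suc i))" if "finite A" for A
    using that
  proof (induction A)
    case empty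
    then show ?case using frob_poly_power[of 1 0] by simp
  next
    case (insert a A)
    have "frob_poly (f a) = f (Suc a)" by (simp only: f_def frob_poly_linear frob_iter_Suc)
    then show ?case using insert by (simp add: frob_poly_mult)
  qed
  then have "f 0 * frob_poly (orbit_poly r x) = f 0 * (\<Prod>i<r. f (Suc i))"
    by (simp add: orbit_poly_def f_def)
  also have "\<dots> = (\<Prod>i<Suc r. f i)" by (simp only: prod.lessThan_Suc_shift)
  also have "\<dots> = f 0 * orbit_poly r x" using fr by (simp add: orbit_poly_def f_def)
  finally have "frob_poly (orbit_poly r x) = orbit_poly r x"
    unfolding mult_cancel_left by (simp add: f_def)
  then show ?thesis unfolding in_polys_1_iff .
qed

text \<open>The number e is the degree of x over F. It exists because the roots of h form a finite
  set stable under Frobenius.\<close>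

lemma frobenius_period:
  assumes h: "h \<in> polys 1" "h \<noteq> 0" and x: "poly h x = 0"
  obtains e where "e > 0" "x \<in> ext e" "inj_on (\<lambda>i. x ^ (q ^ i)) {..<e}"
    "\<And>r. x \<in> ext r \<longleftrightarrow> e dvd r"
proof -
  have rt: "poly h (x ^ (q ^ i)) = 0" for i
    using order_frob_iter[OF h(1), of x i] h(2) x by (metis order_root)
  have "\<not> inj (\<lambda>i. x ^ (q ^ i))"
  proof
    assume "inj (\<lambda>i. x ^ (q ^ i))"
    then have "infinite (range (\<lambda>i. x ^ (q ^ i)))" by (simp add: finite_image_iff)
    moreover have "range (\<lambda>i. x ^ (q ^ i)) \<subseteq> {x. poly h x = 0}" using rt by auto
    ultimately show False using poly_roots_finite[OF h(2)] finite_subset by blast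
  qed
  then obtain i j where ij: "i < j" "x ^ (q ^ i) = x ^ (q ^ j)"
    by (auto simp: inj_def) (metis linorder_neqE_nat)
  have diff: "x \<in> ext (j - i)" if "i \<le> j" "x ^ (q ^ i) = x ^ (q ^ j)" for i j
  proof -
    have "(x ^ (q ^ (j - i))) ^ (q ^ i) = x ^ (q ^ i)"
      using that by (simp flip: power_mult power_add)
    then show ?thesis by (simp add: frob_inj ext_def)
  qed
  define e where "e = (LEAST e. e > 0 \<and> x \<in> ext e)"
  have ex: "\<exists>e. e > 0 \<and> x \<in> ext e" using diff[of i j] ij by (intro exI[of _ "j - i"]) auto
  have e: "e > 0" "x \<in> ext e" using LeastI_ex[OF ex] by (auto simp: e_def)
  have min: "e \<le> r" if "r > 0" "x \<in> ext r" for r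
    unfolding e_def using that by (intro Least_le) auto
  have inj: "inj_on (\<lambda>i. x ^ (q ^ i)) {..<e}"
  proof (rule linorder_inj_onI')
    fix i j assume "i \<in> {..<e}" "j \<in> {..<e}" "i < j"
    then show "x ^ (q ^ i) \<noteq> x ^ (q ^ j)" using diff[of i j] min[of "j - i"] by auto
  qed
  have "x \<in> ext r \<longleftrightarrow> e dvd r" for r
  proof
    assume r: "x \<in> ext r"
    have "x \<in> ext (e * (r div e))" using ext_mult_subset e by blast
    then have "x ^ (q ^ (e * (r div e))) = x" by (simp add: ext_def)
    then have "(x ^ (q ^ (e * (r div e)))) ^ (q ^ (r mod e)) = x ^ (q ^ (r mod e))" by simp
    moreover have "(x ^ (q ^ (e * (r div e)))) ^ (q ^ (r mod e)) = x ^ (q ^ r)"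
      by (simp flip: power_mult power_add)
    ultimately have "x \<in> ext (r mod e)" using r by (simp add: ext_def)
    then have "r mod e = 0" using min[of "r mod e"] e by (metis mod_less_divisor not_le neq0_conv)
    then show "e dvd r" by auto
  next
    assume "e dvd r"
    then show "x \<in> ext r" using e ext_mult_subset by (auto elim!: dvdE)
  qed
  then show ?thesis using that e inj by blast
qed

text \<open>If x has degree e, the admissible r are the multiples e t, and
  \<open>orbit_poly (e * t) x\<close> is the t-th power of the minimal polynomial; it divides h
  exactly for t up to the multiplicity of x in h.\<close>

lemma card_orbit_poly_divisors:
  assumes h: "h \<in> polys 1" "h \<noteq> 0" and x: "poly h x = 0"
  shows "finite {r. r > 0 \<and> x \<in> ext r \<and> orbit_poly r x dvd h}"
    and "card {r. r > 0 \<and> x \<in> ext r \<and> orbit_poly r x dvd h} = order x h"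
proof -
  obtain e where e: "e > 0" "x \<in> ext e" "inj_on (\<lambda>i. x ^ (q ^ i)) {..<e}"
    "\<And>r. x \<in> ext r \<longleftrightarrow> e dvd r" using frobenius_period[OF assms] by blast
  define Orb where "Orb = (\<lambda>i. x ^ (q ^ i)) ` {..<e}"
  have fO: "finite Orb" by (simp add: Orb_def)
  have xO: "x \<in> Orb" using e(1) by (force simp: Orb_def)
  have Oe: "orbit_poly e x = (\<Prod>y\<in>Orb. [:-y, 1:])"
    unfolding orbit_poly_def Orb_def using e(3) by (simp add: prod.reindex)
  have pw: "orbit_poly (e * t) x = orbit_poly e x ^ t" for t
  proof (induction t)
    case (Suc t)
    have "x ^ (q ^ (e * t)) = x" using e(4)[of "e * t"] by (simp add: ext_def)
    then have "x ^ (q ^ (e * t + i)) = x ^ (q ^ i)" for i by (metis power_add power_mult)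
    then have "orbit_poly (e * t + e) x = orbit_poly (e * t) x * orbit_poly e x"
      by (simp add: orbit_poly_def prod_lessThan_add)
    then show ?case using Suc by (simp add: add.commute mult.commute)
  qed (simp add: orbit_poly_def)
  have "proots (orbit_poly e x) = mset_set Orb"
    unfolding Oe by (subst proots_prod) auto
  then have ord: "order y (orbit_poly e x ^ t) = (if y \<in> Orb then t else 0)" for y t
    using fO count_proots[of "orbit_poly e x ^ t" y] by (auto simp: proots_power)
  have "orbit_poly e x ^ t dvd h \<longleftrightarrow> t \<le> order x h" for t
  proof
    assume "orbit_poly e x ^ t dvd h"
    from dvd_imp_order_le[OF h(2) this, of x] show "t \<le> order x h" using ord xO by simp
  next
    assume t: "t \<le> order x h"
    show "orbit_poly e x ^ t dvd h"
      using t h by (intro dvd_if_order_le) (auto simp: ord Orb_def order_frob_iter)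
  qed
  note dvd_iff = this
  have "{r. r > 0 \<and> x \<in> ext r \<and> orbit_poly r x dvd h} = (\<lambda>t. e * t) ` {1..order x h}"
  proof (intro equalityI subsetI)
    fix r assume r: "r \<in> {r. r > 0 \<and> x \<in> ext r \<and> orbit_poly r x dvd h}"
    then obtain t where t: "r = e * t" using e(4) by (auto elim: dvdE)
    have "t \<in> {1..order x h}" using r unfolding t by (auto simp: pw dvd_iff)
    then show "r \<in> (\<lambda>t. e * t) ` {1..order x h}" using t by blast
  next
    fix r assume "r \<in> (\<lambda>t. e * t) ` {1..order x h}"
    then obtain t where "r = e * t" "t \<in> {1..order x h}" by blast
    then show "r \<in> {r. r > 0 \<and> x \<in> ext r \<and> orbit_poly r x dvd h}"
      using e(1,4) by (simp add: pw dvd_iff)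
  qed
  moreover have "inj_on (\<lambda>t. e * t) {1..order x h}" using e(1) by (auto simp: inj_on_def)
  ultimately show "card {r. r > 0 \<and> x \<in> ext r \<and> orbit_poly r x dvd h} = order x h"
    "finite {r. r > 0 \<and> x \<in> ext r \<and> orbit_poly r x dvd h}"
    by (simp_all add: card_image)
qed

text \<open>Summing multiplicities over the roots of h gives its degree. This count plays the part
  of the logarithmic derivative of the Euler product and avoids factoring h into
  irreducibles.\<close>

lemma card_orbit_poly_factorizations:
  assumes h: "h \<in> monics d"
  shows "card {(r, x, g). r \<in> {1..d} \<and> x \<in> ext r \<and> g \<in> monics (d - r) \<and> orbit_poly r x * g = h} = d"
proof -
  have h1: "h \<in> polys 1" "degree h = d" "lead_coeff h = 1" "h \<noteq> 0"
    using h by (auto simp: monics_def)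
  define R where "R = {x. poly h x = 0}"
  define W where "W = (SIGMA x:R. {r. r > 0 \<and> x \<in> ext r \<and> orbit_poly r x dvd h})"
  have finR: "finite R" unfolding R_def using h1 by (intro poly_roots_finite)
  have "bij_betw (\<lambda>(r, x, g). (x, r))
      {(r, x, g). r \<in> {1..d} \<and> x \<in> ext r \<and> g \<in> monics (d - r) \<and> orbit_poly r x * g = h} W"
  proof (rule bij_betw_imageI)
    show "inj_on (\<lambda>(r, x, g). (x, r))
      {(r, x, g). r \<in> {1..d} \<and> x \<in> ext r \<and> g \<in> monics (d - r) \<and> orbit_poly r x * g = h}"
    proof (rule inj_onI)
      fix t t'
      assume A: "t \<in> {(r, x, g). r \<in> {1..d} \<and> x \<in> ext r \<and> g \<in> monics (d - r) \<and> orbit_poly r x * g = h}"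
        "t' \<in> {(r, x, g). r \<in> {1..d} \<and> x \<in> ext r \<and> g \<in> monics (d - r) \<and> orbit_poly r x * g = h}"
        "(case t of (r, x, g) \<Rightarrow> (x, r)) = (case t' of (r, x, g) \<Rightarrow> (x, r))"
      obtain r x g where t: "t = (r, x, g)" by (cases t)
      obtain r' x' g' where t': "t' = (r', x', g')" by (cases t')
      have e: "r' = r" "x' = x" using A(3) by (simp_all add: t t')
      have "orbit_poly r x * g = h" "orbit_poly r x * g' = h"
        using A(1,2) unfolding t t' e by blast+
      then have "orbit_poly r x * g = orbit_poly r x * g'" by (rule trans[OF _ sym])
      then have "g = g'" by (rule mult_left_cancel[THEN iffD1, OF orbit_poly_nonzero])
      then show "t = t'" by (simp add: t t' e)
    qed
    show "(\<lambda>(r, x, g). (x, r)) `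
      {(r, x, g). r \<in> {1..d} \<and> x \<in> ext r \<and> g \<in> monics (d - r) \<and> orbit_poly r x * g = h} = W"
    proof (intro equalityI subsetI)
      fix z assume "z \<in> (\<lambda>(r, x, g). (x, r)) `
        {(r, x, g). r \<in> {1..d} \<and> x \<in> ext r \<and> g \<in> monics (d - r) \<and> orbit_poly r x * g = h}"
      then obtain r x g where z: "z = (x, r)" "r \<in> {1..d}" "x \<in> ext r" "orbit_poly r x * g = h"
        by auto
      have "poly (orbit_poly r x) x = 0" using z(2)
        by (auto simp: orbit_poly_def poly_prod intro!: bexI[of _ 0])
      then have "poly h x = 0" using z(4) by auto
      then show "z \<in> W" using z by (auto simp: W_def R_def)
    next
      fix z assume "z \<in> W"
      then obtain r x where z: "z = (x, r)" "r > 0" "x \<in> ext r" "orbit_poly r x dvd h"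
        by (auto simp: W_def)
      then obtain g where g: "h = orbit_poly r x * g" by (auto elim: dvdE)
      have g0: "g \<noteq> 0" using g h1 by auto
      have "degree g + r = d" using h1 g g0 by (simp add: degree_mult_eq orbit_poly_monic)
      moreover have "lead_coeff g = 1"
        using h1(3) unfolding g lead_coeff_mult orbit_poly_monic(2) by simp
      moreover have "g \<in> polys 1"
      proof -
        have "frob_poly (orbit_poly r x * g) = orbit_poly r x * g"
          using h1(1) unfolding g in_polys_1_iff .
        moreover have "frob_poly (orbit_poly r x) = orbit_poly r x"
          using orbit_poly_in_polys[OF z(3)] unfolding in_polys_1_iff .
        ultimately have "orbit_poly r x * frob_poly g = orbit_poly r x * g"
          unfolding frob_poly_mult by (rule subst[rotated])
        then show ?thesis unfolding in_polys_1_iff by (rule mult_left_cancel[THEN iffD1, OF orbit_poly_nonzero])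
      qed
      ultimately have "g \<in> monics (d - r)" "r \<in> {1..d}" using z by (auto simp: monics_def)
      then show "z \<in> (\<lambda>(r, x, g). (x, r)) `
        {(r, x, g). r \<in> {1..d} \<and> x \<in> ext r \<and> g \<in> monics (d - r) \<and> orbit_poly r x * g = h}"
      proof (intro image_eqI[of _ _ "(r, x, g)"])
        show "z = (case (r, x, g) of (r, x, g) \<Rightarrow> (x, r))" using z(1) by simp
      qed (use z(3) g[symmetric] in blast)
    qed
  qed
  then have "card {(r, x, g). r \<in> {1..d} \<and> x \<in> ext r \<and> g \<in> monics (d - r) \<and> orbit_poly r x * g = h}
    = card W" by (rule bij_betw_same_card)
  also have "\<dots> = (\<Sum>x\<in>R. order x h)"
    unfolding W_def using card_orbit_poly_divisors[OF h1(1,4)] finR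
    by (subst card_SigmaI) (auto simp: R_def)
  also have "\<dots> = size (proots h)"
    using h1 by (simp add: size_multiset_overloaded_eq R_def)
  also have "\<dots> = d" using proots_factorization(2)[OF h1(4)] h1 by simp
  finally show ?thesis .
qed

end

section \<open>The L-function of a character sum\<close>

lemma prod_mset_power: "(\<Prod>x\<in>#A. f x) ^ n = (\<Prod>x\<in>#A. f x ^ n)"
  for f :: "'b \<Rightarrow> 'a :: comm_monoid_mult"
  by (induction A) (auto simp: power_mult_distrib)

lemma prod_mset_diff_swap:
  fixes A B :: "'a :: comm_ring_1 multiset"
  shows "(\<Prod>b\<in>#B. \<Prod>a\<in>#A. b - a) = (-1) ^ (size A * size B) * (\<Prod>a\<in>#A. \<Prod>b\<in>#B. a - b)"
proof (induction B)
  case (add b B)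
  have "(\<Prod>a\<in>#A. b - a) = (-1) ^ size A * (\<Prod>a\<in>#A. a - b)"
    by (induction A) (auto simp: algebra_simps)
  then show ?case using add by (simp add: prod_mset.distrib power_add mult_ac)
qed simp

lemma poly_prod_linear: "poly (\<Prod>a\<in>#A. [:-a, 1:]) x = (\<Prod>a\<in>#A. x - a)"
  for x :: "'a :: comm_ring_1"
  by (induction A) (auto simp: algebra_simps)

context frobenius_tower
begin

section \<open>Norms to the base field\<close>

definition base_norm :: "nat \<Rightarrow> 'c \<Rightarrow> 'c" where
  "base_norm r y = (\<Prod>i<r. y ^ (q ^ i))"

lemma base_norm_in_ext:
  assumes "y \<in> ext r"
  shows "base_norm r y \<in> ext 1"
proof (cases "y = 0")
  case True
  \<comment> \<open>For r = 0 the empty product is 1, even at 0.\<close>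
  have "base_norm r 0 = (0 :: 'c) \<or> base_norm r 0 = (1 :: 'c)"
    by (cases r) (auto simp: base_norm_def prod_zero_iff power_0_left)
  then show ?thesis using True by auto
next
  case False
  define f where "f = (\<lambda>i. y ^ (q ^ i))"
  have fr: "f r = f 0" using assms by (simp add: f_def ext_def)
  have "f 0 * base_norm r y ^ q = f 0 * (\<Prod>i<r. f (Suc i))"
    unfolding base_norm_def prod_power_distrib f_def frob_iter_Suc ..
  also have "\<dots> = (\<Prod>i<Suc r. f i)" by (simp only: prod.lessThan_Suc_shift)
  also have "\<dots> = f 0 * base_norm r y" using fr by (simp add: base_norm_def f_def)
  finally have "base_norm r y ^ q = base_norm r y" using False by (simp add: f_def)
  then show ?thesis by (simp add: ext_def)
qed

text \<open>Frobenius maps the division of h by g to another division of h by g, so the remainder is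
  fixed by uniqueness.\<close>

lemma mod_in_polys:
  assumes "g \<in> polys 1" "h \<in> polys 1" "degree g > 0"
  shows "h mod g \<in> polys 1"
proof (cases "h mod g = 0")
  case False
  then have "degree (h mod g) < degree g" using assms by (intro degree_mod_less') auto
  moreover have "degree (frob_poly (h mod g)) \<le> degree (h mod g)"
    using q_gt_1 by (intro degree_le) (auto simp: coeff_eq_0 power_0_left)
  ultimately have d: "degree (frob_poly (h mod g)) < degree g" by simp
  have "h = frob_poly (h div g * g + h mod g)"
    using assms(2) unfolding in_polys_1_iff by simp
  also have "\<dots> = frob_poly (h mod g) + g * frob_poly (h div g)"
    using assms(1) unfolding frob_poly_add frob_poly_mult in_polys_1_iff
    by (simp only: add.commute mult.commute)
  finally have "h mod g = (frob_poly (h mod g) + g * frob_poly (h div g)) mod g" by simp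
  also have "\<dots> = frob_poly (h mod g)" using d by (simp add: mod_poly_less)
  finally show ?thesis unfolding in_polys_1_iff by simp
qed (use polys_0 in simp)

lemma geometric_q: "q ^ s = (q - 1) * (\<Sum>i<s. q ^ i) + 1"
proof (induction s)
  case (Suc s)
  obtain n where n: "q = Suc n" using q_gt_1 by (cases q) auto
  show ?case using Suc by (simp add: n algebra_simps)
qed simp

text \<open>With P = q^s the exponent is (P - 1)/(q - 1) times P + 1, the shape in which
  \<open>card_norm_fibre_le\<close> counts.\<close>

lemma base_norm_even:
  "base_norm (2 * s) y = y ^ ((\<Sum>i<s. q ^ i) * (q ^ s + 1))"
proof -
  have "(\<Sum>i<2 * s. q ^ i) = (\<Sum>i<s. q ^ i) + (\<Sum>i<s. q ^ (s + i))"
    using sum.atLeastLessThan_concat[of 0 s "2 * s" "\<lambda>i. q ^ i"]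
      sum.shift_bounds_nat_ivl[of "\<lambda>i. q ^ i" 0 s s]
    by (simp add: atLeast0LessThan mult_2 add.commute)
  also have "\<dots> = (\<Sum>i<s. q ^ i) * (q ^ s + 1)"
    by (simp add: power_add sum_distrib_left sum.distrib algebra_simps)
  finally have "(\<Sum>i<2 * s. q ^ i) = (\<Sum>i<s. q ^ i) * (q ^ s + 1)" .
  then show ?thesis unfolding base_norm_def by (simp flip: power_sum)
qed

end

text \<open>The simple root \<open>\<rho>\<close>, which may lie outside F, takes the place of the
  usual condition that G is not a constant times a proper power.\<close>

locale kummer_sum = frobenius_tower q F
  for q :: nat and F :: "'c :: alg_closed_field set" +
  fixes G G1 :: "'c poly" and \<rho> :: 'c and \<psi> :: "'c \<Rightarrow> complex"
  assumes G_polys: "G \<in> polys 1"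
    and G_eq: "G = [:-\<rho>, 1:] * G1" and G1_root: "poly G1 \<rho> \<noteq> 0"
    and \<psi>_mult: "\<And>x y. x \<in> F \<Longrightarrow> y \<in> F \<Longrightarrow> \<psi> (x * y) = \<psi> x * \<psi> y"
    and \<psi>_0: "\<psi> 0 = 0"
    and norm_\<psi>: "\<And>x. x \<in> F \<Longrightarrow> x \<noteq> 0 \<Longrightarrow> norm (\<psi> x) = 1"
    and \<psi>_nontrivial: "\<exists>x\<in>F - {0}. \<psi> x \<noteq> 1"
begin

lemma G_nonzero: "G \<noteq> 0"
  using G_eq G1_root by (metis mult_eq_0_iff pCons_eq_0_iff poly_0 one_neq_zero)

lemma G_root: "poly G \<rho> = 0"
  by (simp add: G_eq)

lemma degree_G_pos: "degree G > 0"
proof (rule ccontr)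
  assume "\<not> degree G > 0"
  then obtain c where "G = [:c:]" by (auto elim: degree_eq_zeroE)
  then show False using G_root G_nonzero by simp
qed

lemma order_G: "order (\<rho> ^ (q ^ i)) G = 1"
  using order_frob_iter[OF G_polys G_nonzero, of \<rho>] order_simple_root[OF G1_root] G_eq by simp

lemma \<psi>_mult': "x \<in> ext 1 \<Longrightarrow> y \<in> ext 1 \<Longrightarrow> \<psi> (x * y) = \<psi> x * \<psi> y"
  using \<psi>_mult by (simp add: ext_1[unfolded One_nat_def])

definition char_sum :: "nat \<Rightarrow> complex" where
  "char_sum r = (\<Sum>x\<in>ext r. \<psi> (base_norm r (poly G x)))"

text \<open>Both are resultants of \<open>G\<close> and \<open>h\<close>, up to a factor that depends only on the degree of a monic \<open>h\<close>.
  The first is used to evaluate \<open>\<psi>\<close> at orbits, the second depends only on \<open>h\<close> modulo \<open>G\<close>.\<close>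
definition root_value :: "'c poly \<Rightarrow> 'c" where
  "root_value h = (\<Prod>x\<in>#proots h. poly G x)"

definition resultant_G :: "'c poly \<Rightarrow> 'c" where
  "resultant_G h = (\<Prod>x\<in>#proots G. poly h x)"

definition L_coeff :: "nat \<Rightarrow> complex" where
  "L_coeff d = (\<Sum>h\<in>monics d. \<psi> (root_value h))"

lemma poly_G_frob: "poly G (x ^ (q ^ i)) = poly G x ^ (q ^ i)"
  using poly_frob[of G i x] G_polys polys_1_subset by (metis subsetD)

lemma root_value_mult: "g \<noteq> 0 \<Longrightarrow> h \<noteq> 0 \<Longrightarrow> root_value (g * h) = root_value g * root_value h"
  by (simp add: root_value_def proots_mult)

lemma root_value_orbit_poly: "root_value (orbit_poly r x) = base_norm r (poly G x)"
proof (induction r)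
  case (Suc r)
  have "orbit_poly (Suc r) x = orbit_poly r x * [:-(x ^ (q ^ r)), 1:]"
    by (simp only: orbit_poly_def prod.lessThan_Suc)
  then have "root_value (orbit_poly (Suc r) x) = root_value (orbit_poly r x) * root_value [:-(x ^ (q ^ r)), 1:]"
    using root_value_mult[of "orbit_poly r x" "[:-(x ^ (q ^ r)), 1:]"] by simp
  then show ?case using Suc
    by (simp add: root_value_def base_norm_def poly_G_frob)
qed (simp add: root_value_def base_norm_def orbit_poly_def)

lemma prod_mset_proots_in_ext:
  assumes h: "h \<in> polys 1" and g: "g \<in> polys 1"
  shows "(\<Prod>x\<in>#proots h. poly g x) \<in> ext 1"
proof -
  have "(\<Prod>x\<in>#proots h. poly g x) ^ q = (\<Prod>x\<in>#proots h. poly g x ^ (q ^ 1))"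
    by (simp add: prod_mset_power)
  also have "\<dots> = (\<Prod>x\<in>#proots h. poly g (x ^ q))"
    unfolding poly_frob[OF g] by simp
  also have "\<dots> = (\<Prod>x\<in>#image_mset (\<lambda>x. x ^ q) (proots h). poly g x)"
    by (simp add: image_mset.compositionality o_def)
  also have "\<dots> = (\<Prod>x\<in>#proots h. poly g x)" unfolding image_mset_frob_proots[OF h] ..
  finally show ?thesis by (simp add: ext_def)
qed

lemma root_value_in_ext: "h \<in> polys 1 \<Longrightarrow> root_value h \<in> ext 1"
  unfolding root_value_def using prod_mset_proots_in_ext G_polys by blast

lemma resultant_G_in_ext: "h \<in> polys 1 \<Longrightarrow> resultant_G h \<in> ext 1"
  unfolding resultant_G_def using prod_mset_proots_in_ext G_polys by blast

lemma resultant_G_mult: "resultant_G (g * h) = resultant_G g * resultant_G h"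
  by (simp add: resultant_G_def prod_mset.distrib)

lemma root_value_eq:
  assumes "lead_coeff h = 1"
  shows "root_value h = lead_coeff G ^ degree h * (-1) ^ (degree G * degree h) * resultant_G h"
proof -
  define A B where "A = proots G" and "B = proots h"
  have h: "h \<noteq> 0" using assms by auto
  have sz: "size A = degree G" "size B = degree h"
    using proots_factorization(2) h G_nonzero by (auto simp: A_def B_def)
  have pG: "poly G x = lead_coeff G * (\<Prod>a\<in>#A. x - a)" for x
    using arg_cong[OF proots_factorization(1)[OF G_nonzero], of "\<lambda>p. poly p x"]
    by (simp add: A_def poly_prod_linear)
  have ph: "poly h x = (\<Prod>b\<in>#B. x - b)" for x
    using arg_cong[OF proots_factorization(1)[OF h], of "\<lambda>p. poly p x"] assms
    by (simp add: B_def poly_prod_linear)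
  have "root_value h = lead_coeff G ^ size B * (\<Prod>b\<in>#B. \<Prod>a\<in>#A. b - a)"
    unfolding root_value_def B_def[symmetric] pG by (simp add: prod_mset.distrib)
  also have "\<dots> = lead_coeff G ^ size B * ((-1) ^ (size A * size B) * resultant_G h)"
    unfolding prod_mset_diff_swap[where A = A and B = B] resultant_G_def A_def[symmetric] ph ..
  finally show ?thesis by (simp add: sz mult.assoc)
qed

text \<open>Expanding the right side gives a sum over triples (r, x, g) of \<open>\<psi>\<close> at
  the root value of \<open>orbit_poly r x * g\<close>, since root values are multiplicative and that
  of an orbit polynomial is a norm. Grouped by this product, each monic h of degree d occurs exactly
  d times.\<close>

lemma newton_identity:
  "of_nat d * L_coeff d = (\<Sum>r=1..d. char_sum r * L_coeff (d - r))"
proof -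
  define T where "T = (SIGMA r:{1..d}. ext r \<times> monics (d - r))"
  define pr where "pr = (\<lambda>(r, x, g). orbit_poly r x * g)"
  have finT: "finite T" unfolding T_def
    using ext_finite_card(1) monics_finite by (intro finite_SigmaI finite_cartesian_product) auto
  have prT: "pr ` T \<subseteq> monics d"
  proof clarify
    fix r x g assume "(r, x, g) \<in> T"
    then have r: "r \<in> {1..d}" and x: "x \<in> ext r" and g: "g \<in> monics (d - r)" by (auto simp: T_def)
    have g': "g \<in> polys 1" "degree g = d - r" "lead_coeff g = 1" "g \<noteq> 0"
      using g by (auto simp: monics_def)
    have "degree (orbit_poly r x * g) = d"
      using r g' by (simp add: degree_mult_eq orbit_poly_monic(1))
    moreover have "lead_coeff (orbit_poly r x * g) = 1"
      unfolding lead_coeff_mult orbit_poly_monic(2) g'(3) by simp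
    moreover have "orbit_poly r x * g \<in> polys 1"
      by (intro polys_closed orbit_poly_in_polys x g')
    ultimately show "pr (r, x, g) \<in> monics d" by (simp add: pr_def monics_def)
  qed
  have "(\<Sum>r=1..d. char_sum r * L_coeff (d - r)) =
    (\<Sum>r=1..d. \<Sum>x\<in>ext r. \<Sum>g\<in>monics (d - r). \<psi> (root_value (orbit_poly r x * g)))"
  proof (rule sum.cong[OF refl])
    fix r assume "r \<in> {1..d}"
    have "\<psi> (root_value (orbit_poly r x * g)) = \<psi> (base_norm r (poly G x)) * \<psi> (root_value g)"
      if "x \<in> ext r" "g \<in> monics (d - r)" for x g
    proof -
      have "g \<noteq> 0" "g \<in> polys 1" using that by (auto simp: monics_def)
      moreover have "base_norm r (poly G x) \<in> ext 1"
        using that G_polys polys_1_subset by (intro base_norm_in_ext poly_in_ext) auto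
      ultimately show ?thesis
        unfolding root_value_mult[OF orbit_poly_nonzero \<open>g \<noteq> 0\<close>] root_value_orbit_poly
        by (intro \<psi>_mult' root_value_in_ext)
    qed
    then show "char_sum r * L_coeff (d - r) =
      (\<Sum>x\<in>ext r. \<Sum>g\<in>monics (d - r). \<psi> (root_value (orbit_poly r x * g)))"
      by (simp add: char_sum_def L_coeff_def sum_product)
  qed
  also have "\<dots> = (\<Sum>r=1..d. \<Sum>y\<in>ext r \<times> monics (d - r). \<psi> (root_value (pr (r, y))))"
    by (simp add: sum.cartesian_product pr_def case_prod_unfold)
  also have "\<dots> = (\<Sum>(r, y)\<in>T. \<psi> (root_value (pr (r, y))))"
    unfolding T_def
    by (rule sum.Sigma) (use ext_finite_card(1) monics_finite in \<open>auto intro!: finite_cartesian_product\<close>)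
  also have "\<dots> = (\<Sum>t\<in>T. \<psi> (root_value (pr t)))" by (simp add: case_prod_unfold)
  also have "\<dots> = (\<Sum>h\<in>monics d. \<Sum>t | t \<in> T \<and> pr t = h. \<psi> (root_value (pr t)))"
    by (rule sum.group[OF finT monics_finite prT, symmetric])
  also have "\<dots> = (\<Sum>h\<in>monics d. of_nat d * \<psi> (root_value h))"
  proof (rule sum.cong[OF refl])
    fix h assume h: "h \<in> monics d"
    have "{t. t \<in> T \<and> pr t = h} = {(r, x, g). r \<in> {1..d} \<and> x \<in> ext r \<and> g \<in> monics (d - r) \<and> orbit_poly r x * g = h}"
    proof (rule Set.set_eqI)
      fix t :: "nat \<times> 'c \<times> 'c poly"
      obtain r x g where t: "t = (r, x, g)" by (cases t)
      show "t \<in> {t. t \<in> T \<and> pr t = h} \<longleftrightarrow>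
        t \<in> {(r, x, g). r \<in> {1..d} \<and> x \<in> ext r \<and> g \<in> monics (d - r) \<and> orbit_poly r x * g = h}"
        unfolding t T_def pr_def by simp
    qed
    then have "card {t. t \<in> T \<and> pr t = h} = d"
      using card_orbit_poly_factorizations[OF h] by simp
    moreover have "(\<Sum>t | t \<in> T \<and> pr t = h. \<psi> (root_value (pr t))) = (\<Sum>t | t \<in> T \<and> pr t = h. \<psi> (root_value h))"
      by (rule sum.cong) auto
    ultimately show "(\<Sum>t | t \<in> T \<and> pr t = h. \<psi> (root_value (pr t))) = of_nat d * \<psi> (root_value h)"
      by simp
  qed
  also have "\<dots> = of_nat d * L_coeff d" by (simp add: L_coeff_def sum_distrib_left)
  finally show ?thesis by simp
qed

text \<open>Let e be the degree of \<open>\<rho>\<close>. A nonzero element \<open>\<alpha>\<close>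
  of F is the norm of some z in \<open>ext e\<close>. If h over F has the value z at
  \<open>\<rho>\<close> and 1 at the roots of G outside its orbit, then the resultant is the norm of
  z, because the roots in the orbit are simple.\<close>

lemma ex_nontrivial_resultant:
  obtains h where "h \<in> polys 1" "\<psi> (resultant_G h) \<noteq> 1" "resultant_G h \<noteq> 0"
proof -
  define R where "R = {x. poly G x = 0}"
  have finR: "finite R" unfolding R_def by (rule poly_roots_finite[OF G_nonzero])
  have \<rho>R: "\<rho> \<in> R" using G_root by (simp add: R_def)
  have frobR: "x ^ q \<in> R \<longleftrightarrow> x \<in> R" for x
    using poly_G_frob[of x 1] q_gt_1 by (auto simp: R_def)
  obtain \<alpha> where \<alpha>: "\<alpha> \<in> ext 1" "\<alpha> \<noteq> 0" "\<psi> \<alpha> \<noteq> 1"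
    using \<psi>_nontrivial unfolding ext_1[symmetric] by auto
  obtain e where e: "e > 0" "\<rho> \<in> ext e" "inj_on (\<lambda>i. \<rho> ^ (q ^ i)) {..<e}"
    by (rule frobenius_period[OF G_polys G_nonzero G_root])
  have \<rho>e: "\<rho> ^ (q ^ e) = \<rho>" using e(2) by (simp add: ext_def)
  have "(\<Sum>i<e. q ^ i) > 0" using e(1) q_gt_1 by (intro sum_pos) auto
  \<comment> \<open>The norm equation is solved in the closure first;
    \<open>\<alpha> ^ q = \<alpha>\<close> then forces z into \<open>ext e\<close>.\<close>
  then obtain z :: 'c where "z ^ (\<Sum>i<e. q ^ i) = \<alpha>" using nth_root_exists by blast
  then have z: "base_norm e z = \<alpha>" by (simp add: base_norm_def power_sum)
  have "base_norm e (0 :: 'c) = 0"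
    unfolding base_norm_def by (rule prod_zero) (use e(1) in \<open>auto intro!: bexI[of _ 0]\<close>)
  then have z0: "z \<noteq> 0" using z \<alpha>(2) by auto
  have ze: "z ^ (q ^ e) = z"
  proof -
    define f where "f = (\<lambda>i. z ^ (q ^ i))"
    have "\<alpha> ^ q = (\<Prod>i<e. f (Suc i))"
      unfolding z[symmetric] base_norm_def prod_power_distrib f_def frob_iter_Suc ..
    then have "f 0 * \<alpha> ^ q = (\<Prod>i<Suc e. f i)" by (simp only: prod.lessThan_Suc_shift)
    also have "\<dots> = \<alpha> * f e" using z by (simp add: base_norm_def f_def)
    finally show ?thesis using \<alpha> by (simp add: ext_def f_def)
  qed
  define Orb where "Orb = (\<lambda>i. \<rho> ^ (q ^ i)) ` {..<e}"
  have OrbR: "Orb \<subseteq> R"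
    using poly_G_frob G_root q_gt_1 by (auto simp: Orb_def R_def power_0_left)
  \<comment> \<open>Conjugates of z along the orbit of \<open>\<rho>\<close> and 1 elsewhere: these
    values commute with Frobenius, as \<open>y_frob\<close> shows.\<close>
  define y where "y = (\<lambda>x. if x \<in> Orb then z ^ (q ^ the_inv_into {..<e} (\<lambda>i. \<rho> ^ (q ^ i)) x) else 1)"
  have y_orb: "y (\<rho> ^ (q ^ i)) = z ^ (q ^ i)" if "i < e" for i
    using that the_inv_into_f_f[OF e(3), of i] by (simp add: y_def Orb_def)
  have y_frob: "y (x ^ q) = y x ^ q" for x
  proof (cases "x \<in> Orb")
    case True
    then obtain i where i: "i < e" "x = \<rho> ^ (q ^ i)" by (auto simp: Orb_def)
    have xq: "x ^ q = \<rho> ^ (q ^ Suc i)" unfolding i(2) frob_iter_Suc ..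
    show ?thesis
    proof (cases "Suc i = e")
      case True
      then have "y (x ^ q) = y (\<rho> ^ (q ^ 0))" using xq \<rho>e by simp
      also have "\<dots> = z" using y_orb[of 0] e(1) by simp
      also have "\<dots> = (z ^ (q ^ i)) ^ q" using True ze unfolding frob_iter_Suc by simp
      finally show ?thesis using y_orb[OF i(1)] i(2) by simp
    next
      case False
      then have "y (x ^ q) = z ^ (q ^ Suc i)" using y_orb[of "Suc i"] i(1) xq by simp
      then show ?thesis using y_orb[OF i(1)] i(2) frob_iter_Suc by metis
    qed
  next
    case False
    have "x ^ q \<notin> Orb"
    proof
      assume "x ^ q \<in> Orb"
      then obtain i where i: "i < e" "x ^ q = \<rho> ^ (q ^ i)" by (auto simp: Orb_def)
      obtain j where j: "j < e" "\<rho> ^ (q ^ i) = (\<rho> ^ (q ^ j)) ^ q"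
      proof (cases i)
        case 0
        then have "\<rho> ^ (q ^ i) = (\<rho> ^ (q ^ (e - 1))) ^ q"
          unfolding frob_iter_Suc using \<rho>e e(1) by simp
        then show ?thesis using that[of "e - 1"] e(1) by simp
      next
        case (Suc j)
        then show ?thesis using that[of j] i(1) frob_iter_Suc by (metis Suc_lessD)
      qed
      then have "x = \<rho> ^ (q ^ j)" using i(2) j(2) frob_inj[of x 1 "\<rho> ^ (q ^ j)"] by simp
      then show False using False j(1) by (auto simp: Orb_def)
    qed
    then show ?thesis using False by (simp add: y_def)
  qed
  obtain h where h: "degree h \<le> card R - 1" "\<forall>x\<in>R. poly h x = y x"
    using lagrange_interpolation[OF finR] by blast
  have h_polys: "h \<in> polys 1"
  proof -
    \<comment> \<open>Both \<open>frob_poly h\<close> and \<open>h\<close> interpolate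
      \<open>y\<close> on \<open>R\<close> in degree less than \<open>card R\<close>, so they
      coincide.\<close>
    define k where "k = frob_poly h - h"
    have "degree (frob_poly h) \<le> degree h"
      using q_gt_1 by (intro degree_le) (auto simp: coeff_eq_0 power_0_left)
    then have dk: "degree k \<le> card R - 1" unfolding k_def using h(1) by (intro degree_diff_le) auto
    have "poly k x = 0" if "x \<in> R" for x
    proof -
      obtain u where u: "x = u ^ q" using frob_bij by (metis bij_pointE)
      then have "u \<in> R" using that frobR by simp
      then have "poly (frob_poly h) x = y x" using h(2) by (simp add: u poly_frob_poly y_frob)
      then show ?thesis using h(2) that by (simp add: k_def)
    qed
    then have Rk: "R \<subseteq> {x. poly k x = 0}" by auto
    have "card R > 0" using finR \<rho>R by (auto simp: card_gt_0_iff)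
    have "k = 0"
    proof (rule ccontr)
      assume "k \<noteq> 0"
      then have "card R \<le> degree k"
        using card_poly_roots_bound[of k] card_mono[OF poly_roots_finite Rk] by linarith
      then show False using dk \<open>card R > 0\<close> by linarith
    qed
    then show ?thesis unfolding in_polys_1_iff k_def by simp
  qed
  have "resultant_G h = (\<Prod>x\<in>R. poly h x ^ order x G)"
    unfolding resultant_G_def using G_nonzero by (simp add: image_prod_mset_multiplicity R_def)
  also have "\<dots> = (\<Prod>x\<in>R. y x ^ order x G)" using h(2) by simp
  also have "\<dots> = (\<Prod>x\<in>Orb. y x ^ order x G)"
    using finR OrbR by (intro prod.mono_neutral_right) (auto simp: y_def)
  also have "\<dots> = (\<Prod>i<e. y (\<rho> ^ (q ^ i)) ^ order (\<rho> ^ (q ^ i)) G)"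
    unfolding Orb_def using e(3) by (simp add: prod.reindex)
  also have "\<dots> = base_norm e z" unfolding base_norm_def order_G by (intro prod.cong) (auto simp: y_orb)
  finally have "resultant_G h = \<alpha>" using z by simp
  then show ?thesis using that h_polys \<alpha> by simp
qed

text \<open>Multiplication by a polynomial with nontrivial \<open>\<psi>\<close>-value permutes the residue classes modulo \<open>G\<close>,
  and monic polynomials of degree at least \<open>degree G\<close> are equidistributed in these classes.\<close>
lemma L_coeff_eq_0:
  assumes d: "d \<ge> degree G"
  shows "L_coeff d = 0"
proof -
  obtain h0 where h0: "h0 \<in> polys 1" "\<psi> (resultant_G h0) \<noteq> 1" "resultant_G h0 \<noteq> 0"
    using ex_nontrivial_resultant by blast
  \<comment> \<open>This keeps the quotient by G and replaces the residue of h by that of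
    \<open>h * h0\<close>. The correction has degree less than \<open>degree G\<close>, so a monic h
    of degree d stays one.\<close>
  define \<tau> where "\<tau> = (\<lambda>h. h + ((h * h0) mod G - h mod G))"
  \<comment> \<open>The nonzero resultant says that \<open>h0\<close> vanishes at no root of G, so
    the multiplicities have to come from k.\<close>
  have cancel: "G dvd k" if "G dvd k * h0" for k
  proof (cases "k = 0")
    case False
    have h0_nz: "h0 \<noteq> 0" if "poly G x = 0" for x
      using that h0(3) G_nonzero by (auto simp: resultant_G_def prod_mset_zero_iff)
    have kh: "k * h0 \<noteq> 0" using False h0_nz G_root by auto
    show ?thesis
    proof (rule dvd_if_order_le[OF G_nonzero False])
      fix x
      show "order x G \<le> order x k"
      proof (cases "poly G x = 0")
        case True
        then have "poly h0 x \<noteq> 0"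
          using h0(3) G_nonzero by (auto simp: resultant_G_def prod_mset_zero_iff)
        then have "order x h0 = 0" by (rule order_0I)
        moreover have "order x G \<le> order x (k * h0)" using kh that by (rule dvd_imp_order_le)
        ultimately show ?thesis using order_mult[OF kh, of x] by simp
      qed (simp add: order_0I)
    qed
  qed simp
  have dm: "degree (k mod G) < degree G" for k
    using degree_mod_less[OF G_nonzero, of k] degree_G_pos by auto
  have \<tau>_monics: "\<tau> h \<in> monics d" if h: "h \<in> monics d" for h
  proof -
    have h': "h \<in> polys 1" "degree h = d" "lead_coeff h = 1" "h \<noteq> 0" using h by (auto simp: monics_def)
    have small: "degree ((h * h0) mod G - h mod G) < degree G"
      by (intro degree_diff_less dm)
    have "\<tau> h \<in> polys 1" unfolding \<tau>_def
      by (intro polys_closed mod_in_polys G_polys h' h0 degree_G_pos)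
    moreover have "degree (\<tau> h) = d"
      unfolding \<tau>_def using small d h' by (subst degree_add_eq_left) auto
    moreover have "coeff (\<tau> h) d = 1"
      using small d h' by (simp add: \<tau>_def coeff_eq_0 flip: coeff_diff)
    ultimately show ?thesis by (simp add: monics_def)
  qed
  have inj: "inj_on \<tau> (monics d)"
  proof (rule inj_onI)
    fix h h' assume eq: "\<tau> h = \<tau> h'"
    have t: "\<tau> h = G * (h div G) + (h * h0) mod G" for h
      unfolding \<tau>_def using mult_div_mod_eq[of G h] by (simp add: algebra_simps)
    have md: "((h * h0) mod G) div G = 0" for h
      by (intro div_poly_less dm)
    have "\<tau> h div G = h div G" "\<tau> h mod G = (h * h0) mod G" for h
      unfolding t using G_nonzero md by (auto simp: poly_div_add_left)
    then have dv: "h div G = h' div G" and "(h * h0) mod G = (h' * h0) mod G"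
      using eq by metis+
    then have "G dvd (h - h') * h0" by (simp add: mod_eq_dvd_iff algebra_simps)
    then have "G dvd h - h'" by (rule cancel)
    then have "h mod G = h' mod G" by (simp add: mod_eq_dvd_iff)
    then show "h = h'" using dv by (metis div_mult_mod_eq)
  qed
  have bij: "bij_betw \<tau> (monics d) (monics d)"
    unfolding bij_betw_def using inj endo_inj_surj[OF monics_finite _ inj] \<tau>_monics by blast
  define \<kappa> where "\<kappa> = lead_coeff G ^ d * (-1) ^ (degree G * d)"
  have \<kappa>: "\<kappa> \<in> ext 1"
  proof -
    have "lead_coeff G \<in> ext 1" using G_polys by (simp add: polys_def)
    then show ?thesis unfolding \<kappa>_def by (intro ext_closed ext_one)
  qed
  have val: "\<psi> (root_value h) = \<psi> \<kappa> * \<psi> (resultant_G h)" if "h \<in> monics d" for h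
  proof -
    have h: "h \<in> polys 1" "degree h = d" "lead_coeff h = 1" using that by (auto simp: monics_def)
    then show ?thesis using root_value_eq[OF h(3)] \<psi>_mult'[OF \<kappa> resultant_G_in_ext[OF h(1)]]
      by (simp add: \<kappa>_def)
  qed
  have res: "resultant_G (\<tau> h) = resultant_G h * resultant_G h0" for h
  proof -
    have "poly (\<tau> h) x = poly (h * h0) x" if "x \<in># proots G" for x
    proof -
      have x: "poly G x = 0" using that G_nonzero by simp
      have "poly (k mod G) x = poly k x" for k
      proof -
        have "poly (k div G * G + k mod G) x = poly (k mod G) x" unfolding poly_add poly_mult x by simp
        then show ?thesis unfolding div_mult_mod_eq by simp
      qed
      then show ?thesis by (simp add: \<tau>_def)
    qed
    then have "resultant_G (\<tau> h) = resultant_G (h * h0)"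
      unfolding resultant_G_def by (intro arg_cong[where f = prod_mset] image_mset_cong)
    then show ?thesis by (simp add: resultant_G_mult)
  qed
  have "L_coeff d = (\<Sum>h\<in>monics d. \<psi> (root_value (\<tau> h)))"
    unfolding L_coeff_def by (rule sum.reindex_bij_betw[OF bij, symmetric])
  also have "\<dots> = (\<Sum>h\<in>monics d. \<psi> (root_value h) * \<psi> (resultant_G h0))"
  proof (rule sum.cong[OF refl])
    fix h assume h: "h \<in> monics d"
    then have "h \<in> polys 1" by (auto simp: monics_def)
    then have "\<psi> (resultant_G (\<tau> h)) = \<psi> (resultant_G h) * \<psi> (resultant_G h0)"
      unfolding res by (intro \<psi>_mult' resultant_G_in_ext h0)
    then show "\<psi> (root_value (\<tau> h)) = \<psi> (root_value h) * \<psi> (resultant_G h0)"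
      using val[OF h] val[OF \<tau>_monics[OF h]] by simp
  qed
  also have "\<dots> = L_coeff d * \<psi> (resultant_G h0)"
    by (simp add: L_coeff_def sum_distrib_right)
  finally show ?thesis using h0(2) by (metis mult_cancel_left1)
qed

end

section \<open>Weil's bound\<close>

text \<open>X L'/L is minus the sum of the series w X/(1 - w X), here cleared of the denominator
  L.\<close>

lemma fps_log_deriv_prod:
  fixes xs :: "complex list"
  defines "L \<equiv> (\<Prod>w\<leftarrow>xs. 1 - fps_const w * fps_X)"
  shows "fps_X * fps_deriv L = - L * Abs_fps (\<lambda>r. if r = 0 then 0 else \<Sum>w\<leftarrow>xs. w ^ r)"
  unfolding L_def
proof (induction xs)
  case Nil
  have "Abs_fps (\<lambda>r. if r = 0 then 0 else \<Sum>w\<leftarrow>([] :: complex list). w ^ r) = 0"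
    by (simp add: fps_eq_iff)
  then show ?case by simp
next
  case (Cons w xs)
  define M where "M = (\<Prod>w\<leftarrow>xs. 1 - fps_const w * fps_X)"
  define E where "E = Abs_fps (\<lambda>r. if r = 0 then 0 else w ^ r)"
  define T where "T = Abs_fps (\<lambda>r. if r = 0 then 0 else \<Sum>w\<leftarrow>xs. w ^ r)"
  have ET: "Abs_fps (\<lambda>r. if r = 0 then 0 else \<Sum>w\<leftarrow>w # xs. w ^ r) = E + T"
    by (auto simp: fps_eq_iff E_def T_def)
  have E: "(1 - fps_const w * fps_X) * E = fps_const w * fps_X"
  proof (rule fps_ext)
    fix n
    show "((1 - fps_const w * fps_X) * E) $ n = (fps_const w * fps_X) $ n"
    proof (cases n)
      case (Suc k)
      have "(fps_const w * fps_X * E) $ Suc k = w * E $ k"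
        by (simp add: mult.assoc)
      then show ?thesis using Suc by (cases k) (auto simp: left_diff_distrib E_def)
    qed (simp add: E_def mult.assoc)
  qed
  have "fps_X * fps_deriv ((1 - fps_const w * fps_X) * M)
    = (1 - fps_const w * fps_X) * (fps_X * fps_deriv M) - fps_const w * fps_X * M"
    by (simp add: algebra_simps)
  also have "\<dots> = (1 - fps_const w * fps_X) * (- M * T) - (1 - fps_const w * fps_X) * E * M"
    using Cons E by (simp add: M_def T_def)
  also have "\<dots> = - ((1 - fps_const w * fps_X) * M) * (E + T)" by (simp add: algebra_simps)
  finally show ?case unfolding ET unfolding list.map prod_list.Cons M_def[symmetric] .
qed

text \<open>The \<open>Z d\<close> are the coefficients of a polynomial P with constant term 1,
  which therefore splits into factors 1 - w X. The recursion says that X P' is P times the series of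
  the \<open>S r\<close>; the logarithmic derivative gives the same with minus the power sums, and P
  can be cancelled.\<close>

lemma power_sums_of_newton_identities:
  fixes Z S :: "nat \<Rightarrow> complex"
  assumes Z0: "Z 0 = 1" and Z_fin: "\<And>d. d \<ge> m \<Longrightarrow> Z d = 0"
    and newton: "\<And>d. of_nat d * Z d = (\<Sum>r=1..d. S r * Z (d - r))"
  obtains ws where "length ws \<le> m - 1" "\<And>r. r > 0 \<Longrightarrow> S r = - (\<Sum>w\<leftarrow>ws. w ^ r)"
proof -
  have m: "m > 0" using Z0 Z_fin[of 0] by (cases m) auto
  define p where "p = Poly (map Z [0..<m])"
  have cp: "coeff p d = Z d" for d
    using Z_fin by (auto simp: p_def nth_default_def)
  have dp: "degree p \<le> m - 1"
    using Z_fin m by (intro degree_le) (auto simp: cp)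
  have p0: "p \<noteq> 0" using cp[of 0] Z0 by auto
  obtain A where A: "size A = degree p" "p = smult (lead_coeff p) (\<Prod>x\<in>#A. [:-x, 1:])"
    using alg_closed_imp_factorization[OF p0] by blast
  obtain as where as: "A = mset as" by (metis ex_mset)
  define ws where "ws = map inverse as"
  have p_as: "p = smult (lead_coeff p) (\<Prod>x\<leftarrow>as. [:-x, 1:])"
    using A(2) unfolding as by (simp add: prod_mset_prod_list flip: mset_map)
  have as0: "a \<noteq> 0" if "a \<in> set as" for a
  proof
    assume "a = 0"
    have "poly (\<Prod>x\<in>#A. [:-x, 1:]) a = 0"
      unfolding poly_prod_linear using that by (auto simp: as prod_mset_zero_iff)
    then have "poly p a = 0" using A(2) by (metis poly_smult mult_zero_right)
    then show False using \<open>a = 0\<close> cp[of 0] Z0 by (simp add: poly_0_coeff_0)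
  qed
  have "\<exists>c. (\<Prod>x\<leftarrow>as. [:-x, 1:]) = smult c (\<Prod>w\<leftarrow>ws. [:1, -w:])"
    unfolding ws_def using as0
  proof (induction as)
    case Nil
    then show ?case by (intro exI[of _ 1]) simp
  next
    case (Cons a as)
    then obtain c where c: "(\<Prod>x\<leftarrow>as. [:-x, 1:]) = smult c (\<Prod>w\<leftarrow>map inverse as. [:1, -w:])" by auto
    have "[:-a, 1:] = smult (-a) [:1, - inverse a:]" using Cons(2)[of a] by simp
    then have "(\<Prod>x\<leftarrow>a # as. [:-x, 1:]) = smult (c * - a) (\<Prod>w\<leftarrow>map inverse (a # as). [:1, -w:])"
      by (simp only: list.map prod_list.Cons c mult_smult_left mult_smult_right smult_smult)
    then show ?case by blast
  qed
  then obtain c0 where c0: "(\<Prod>x\<leftarrow>as. [:-x, 1:]) = smult c0 (\<Prod>w\<leftarrow>ws. [:1, -w:])" by blast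
  have "p = smult (lead_coeff p * c0) (\<Prod>w\<leftarrow>ws. [:1, -w:])"
    using p_as unfolding c0 smult_smult .
  then obtain c where c: "p = smult c (\<Prod>w\<leftarrow>ws. [:1, -w:])" by blast
  have "c = 1"
  proof -
    have "poly (\<Prod>w\<leftarrow>ws. [:1, -w:]) 0 = 1" by (induction ws) auto
    then have "poly p 0 = c" by (subst c) simp
    then show ?thesis using cp[of 0] Z0 by (simp add: poly_0_coeff_0)
  qed
  then have p_ws: "p = (\<Prod>w\<leftarrow>ws. [:1, -w:])" using c by simp
  define P where "P = fps_of_poly p"
  have P_prod: "P = (\<Prod>w\<leftarrow>ws. 1 - fps_const w * fps_X)"
    unfolding P_def p_ws
  proof (induction ws)
    case (Cons w ws)
    have "fps_of_poly [:1, -w:] = 1 - fps_const w * fps_X"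
      by (simp add: fps_of_poly_pCons flip: fps_const_neg)
    then show ?case using Cons by (simp only: list.map prod_list.Cons fps_of_poly_mult)
  qed simp
  have P_nth: "P $ d = Z d" for d by (simp add: P_def cp)
  have P0: "P \<noteq> 0" using P_nth[of 0] Z0 by auto
  define SF where "SF = Abs_fps (\<lambda>r. if r = 0 then 0 else S r)"
  define T where "T = Abs_fps (\<lambda>r. if r = 0 then 0 else \<Sum>w\<leftarrow>ws. w ^ r)"
  have "fps_X * fps_deriv P = SF * P"
  proof (rule fps_ext)
    fix d
    have "(SF * P) $ d = (\<Sum>r=0..d. SF $ r * P $ (d - r))" by (rule fps_mult_nth)
    also have "\<dots> = (\<Sum>r=1..d. SF $ r * P $ (d - r))"
      by (rule sum.mono_neutral_right) (auto simp: SF_def)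
    also have "\<dots> = of_nat d * Z d" by (simp add: newton SF_def P_nth)
    finally show "(fps_X * fps_deriv P) $ d = (SF * P) $ d"
      by (cases d) (simp_all add: P_nth)
  qed
  then have "SF * P = - P * T" using fps_log_deriv_prod[of ws] by (simp add: P_prod T_def)
  then have "P * (SF + T) = 0" by (simp add: algebra_simps)
  then have "SF + T = 0" using P0 by simp
  then have "S r = - (\<Sum>w\<leftarrow>ws. w ^ r)" if "r > 0" for r
  proof -
    have "(SF + T) $ r = 0 $ r" unfolding \<open>SF + T = 0\<close> ..
    then show ?thesis using that by (simp add: SF_def T_def eq_neg_iff_add_eq_0)
  qed
  moreover have "length ws \<le> m - 1" using A(1) dp by (simp add: ws_def as)
  ultimately show ?thesis using that by blast
qed

text \<open>By Dirichlet's simultaneous approximation theorem there are arbitrarily large \<open>k\<close> for which all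
  the \<open>u ^ k\<close> have argument at most \<open>\<pi> / 3\<close>, so that no cancellation occurs.\<close>
lemma norm_le_1_if_power_sums_bounded:
  fixes us :: "complex list"
  assumes bound: "\<And>k. k \<ge> N \<Longrightarrow> norm (\<Sum>u\<leftarrow>us. u ^ k) \<le> C" and u: "u \<in> set us"
  shows "norm u \<le> 1"
proof (rule ccontr)
  assume "\<not> norm u \<le> 1"
  then have u1: "norm u > 1" by simp
  obtain M where M: "norm u ^ M > 2 * C" using real_arch_pow[OF u1] by blast
  \<comment> \<open>The factor K inside \<open>\<theta>\<close> makes the exponent k a multiple of
    K, hence at least M and N. An error of a sixth of a turn is an angle of at most \<pi>/3, whose
    cosine is at least 1/2; M makes the term of u alone exceed C.\<close>
  define K where "K = max 1 (max M N)"
  define \<theta> where "\<theta> = (\<lambda>i. real K * Arg (us ! i) / (2 * pi))"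
  have "\<exists>t p. 0 < t \<and> (\<forall>i<length us. \<bar>of_int t * \<theta> i - of_int (p i)\<bar> < 1 / real 6)"
    by (rule Dirichlet_approx_simult[where N = 6 and n = "length us" and \<theta> = \<theta>, OF zero_less_numeral])
      blast
  then obtain t p where t: "0 < t" "\<And>i. i < length us \<Longrightarrow> \<bar>of_int t * \<theta> i - of_int (p i)\<bar> < 1 / real 6"
    by blast
  define k where "k = K * nat t"
  have kK: "k \<ge> K" using t(1) by (simp add: k_def Suc_le_eq)
  then have kN: "k \<ge> N" by (simp add: K_def)
  have Re: "Re ((us ! i) ^ k) \<ge> norm (us ! i) ^ k / 2" if i: "i < length us" for i
  proof -
    define v where "v = us ! i"
    define y where "y = of_int t * \<theta> i - of_int (p i)"
    have y: "\<bar>y\<bar> < 1 / 6" using t(2)[OF i] by (simp add: y_def)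
    have "real k * Arg v = 2 * pi * (of_int t * \<theta> i)"
      using t(1) by (simp add: k_def \<theta>_def v_def field_simps)
    also have "\<dots> = 2 * pi * y + (2 * pi) * of_int (p i)" by (simp add: y_def algebra_simps)
    finally have ang: "real k * Arg v = 2 * pi * y + (2 * pi) * of_int (p i)" .
    have "cos (real k * Arg v) = cos (2 * pi * y)"
      unfolding ang by (simp only: cos_add cos_int_2pin sin_int_2pin mult_1_right mult_zero_right diff_zero)
    also have "\<dots> = cos \<bar>2 * pi * y\<bar>" by (simp add: abs_if)
    also have "\<dots> \<ge> cos (pi / 3)"
      using y by (intro cos_monotone_0_pi_le) (auto simp: abs_mult)
    finally have c: "cos (real k * Arg v) \<ge> 1 / 2" by (simp add: cos_60)
    have "v ^ k = rcis (norm v) (Arg v) ^ k" by (simp only: rcis_cmod_Arg)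
    also have "\<dots> = rcis (norm v ^ k) (real k * Arg v)" by (rule DeMoivre2)
    finally have "Re (v ^ k) = norm v ^ k * cos (real k * Arg v)" by simp
    also have "\<dots> \<ge> norm v ^ k * (1 / 2)" by (intro mult_left_mono c) simp
    finally show ?thesis by (simp add: v_def)
  qed
  obtain j where j: "j < length us" "us ! j = u" using u by (auto simp: in_set_conv_nth)
  have "norm u ^ k / 2 \<le> Re ((us ! j) ^ k)" using Re[OF j(1)] j by simp
  also have "\<dots> \<le> (\<Sum>i<length us. Re ((us ! i) ^ k))"
    using j(1) by (intro member_le_sum order_trans[OF _ Re]) auto
  also have "\<dots> = Re (\<Sum>u\<leftarrow>us. u ^ k)"
    by (simp add: sum_list_sum_nth atLeast0LessThan)
  also have "\<dots> \<le> norm (\<Sum>u\<leftarrow>us. u ^ k)" by (rule complex_Re_le_cmod)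
  also have "\<dots> \<le> C" using kN by (rule bound)
  finally have "norm u ^ k \<le> 2 * C" by simp
  moreover have "norm u ^ M \<le> norm u ^ k"
    using u1 kK by (intro power_increasing) (auto simp: K_def)
  ultimately show False using M by linarith
qed

context kummer_sum
begin

lemma \<psi>_1: "\<psi> 1 = 1"
  using \<psi>_mult'[of 1 1] norm_\<psi>[of 1] F_eq by auto

lemma L_coeff_0: "L_coeff 0 = 1"
proof -
  have "monics 0 = {1}"
    by (auto simp: monics_def polys_1[unfolded One_nat_def] elim!: degree_eq_zeroE)
  then show ?thesis by (simp add: L_coeff_def root_value_def \<psi>_1)
qed

lemma sum_\<psi>: "(\<Sum>x\<in>ext 1 - {0}. \<psi> x) = 0"
proof -
  obtain a where a: "a \<in> ext 1" "a \<noteq> 0" "\<psi> a \<noteq> 1"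
    using \<psi>_nontrivial unfolding ext_1[symmetric] by auto
  have "(\<Sum>x\<in>ext 1 - {0}. \<psi> x) = (\<Sum>x\<in>ext 1 - {0}. \<psi> (a * x))"
    by (rule sum.reindex_bij_witness[of _ "\<lambda>x. a * x" "\<lambda>x. inverse a * x"])
      (use a in \<open>auto intro!: ext_closed simp: mult.assoc[symmetric]\<close>)
  also have "\<dots> = \<psi> a * (\<Sum>x\<in>ext 1 - {0}. \<psi> x)"
    unfolding sum_distrib_left by (rule sum.cong) (use a \<psi>_mult' in auto)
  finally show ?thesis using a(3) by (metis mult_cancel_right1)
qed

text \<open>The q - 1 fibres all have size at most M and together contain at least P^2 - m points,
  so the sum of the deficits M - \<open>card (N \<alpha>)\<close> is of order P. Since
  \<open>\<psi>\<close> sums to zero over the nonzero elements of F, subtracting M from every fibre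
  size leaves the character sum unchanged, and the deficits bound it.\<close>

lemma norm_char_sum_even_le:
  assumes s: "s > 0" and \<rho>: "\<rho> \<in> ext s" and large: "q ^ s > 2 * degree G + 4"
  shows "norm (char_sum (2 * s)) \<le> real ((q - 1) * (2 * degree G + 3) + degree G) * real (q ^ s)"
proof -
  define P w m where "P = q ^ s" and "w = (\<Sum>i<s. q ^ i)" and "m = degree G"
  define c where "c = w * (P + 1)"
  define Es where "Es = ext (2 * s)"
  define A where "A = ext 1 - {0}"
  define N where "N = (\<lambda>\<alpha>. {x \<in> Es. poly G x ^ c = \<alpha>})"
  have P_eq: "P = (q - 1) * w + 1" unfolding P_def w_def by (rule geometric_q)
  have finEs: "finite Es" and cardEs: "card Es = P * P"
    using ext_finite_card[of "2 * s"] s by (auto simp: Es_def P_def mult_2 power_add)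
  have finA: "finite A" and cardA: "card A = q - 1"
    using ext_finite_card[of 1] by (auto simp: A_def)
  have tn: "base_norm (2 * s) (poly G x) = poly G x ^ c" for x
    by (simp add: base_norm_even c_def w_def P_def)
  have cpos: "c > 0" unfolding c_def using large P_eq by (cases w) (auto simp: P_def)
  define M where "M = c + (2 * m + 3) * P"
  have NM: "card (N \<alpha>) \<le> M" if "\<alpha> \<in> A" for \<alpha>
    unfolding N_def Es_def c_def M_def
    using that ext_1_subset[of "2 * s"] large
    by (intro card_norm_fibre_le[OF G_polys m_def G_eq G1_root s \<rho> P_def P_eq])
      (auto simp: A_def P_def m_def)
  have in_ext: "poly G x ^ c \<in> ext 1" if "x \<in> Es" for x
    using that tn[of x] G_polys polys_1_subset unfolding Es_def
    by (metis base_norm_in_ext poly_in_ext subsetD)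
  define Es' where "Es' = {x \<in> Es. poly G x \<noteq> 0}"
  have img: "(\<lambda>x. poly G x ^ c) ` Es' \<subseteq> A" using in_ext by (auto simp: Es'_def A_def)
  have finEs': "finite Es'" using finEs by (simp add: Es'_def)
  have NEs': "{x \<in> Es'. poly G x ^ c = \<alpha>} = N \<alpha>" if "\<alpha> \<in> A" for \<alpha>
    using that cpos by (auto simp: N_def Es'_def A_def power_0_left)
  have "char_sum (2 * s) = (\<Sum>x\<in>Es. \<psi> (poly G x ^ c))"
    by (simp add: char_sum_def tn Es_def)
  also have "\<dots> = (\<Sum>x\<in>Es'. \<psi> (poly G x ^ c))"
    using finEs cpos by (intro sum.mono_neutral_right) (auto simp: Es'_def \<psi>_0 power_0_left)
  also have "\<dots> = (\<Sum>\<alpha>\<in>A. \<Sum>x\<in>{x \<in> Es'. poly G x ^ c = \<alpha>}. \<psi> (poly G x ^ c))"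
    using sum.group[OF finEs' finA img, of "\<lambda>x. \<psi> (poly G x ^ c)"] by simp
  also have "\<dots> = (\<Sum>\<alpha>\<in>A. of_nat (card (N \<alpha>)) * \<psi> \<alpha>)"
  proof (rule sum.cong[OF refl])
    fix \<alpha> assume \<alpha>: "\<alpha> \<in> A"
    have "(\<Sum>x\<in>{x \<in> Es'. poly G x ^ c = \<alpha>}. \<psi> (poly G x ^ c)) = (\<Sum>x\<in>{x \<in> Es'. poly G x ^ c = \<alpha>}. \<psi> \<alpha>)"
      by (rule sum.cong) auto
    then show "(\<Sum>x\<in>{x \<in> Es'. poly G x ^ c = \<alpha>}. \<psi> (poly G x ^ c)) = of_nat (card (N \<alpha>)) * \<psi> \<alpha>"
      by (simp add: NEs'[OF \<alpha>])
  qed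
  also have "\<dots> = (\<Sum>\<alpha>\<in>A. (of_nat (card (N \<alpha>)) - of_nat M) * \<psi> \<alpha>)"
    using sum_\<psi> by (simp add: left_diff_distrib sum_subtractf A_def flip: sum_distrib_left)
  finally have cs: "char_sum (2 * s) = (\<Sum>\<alpha>\<in>A. (of_nat (card (N \<alpha>)) - of_nat M) * \<psi> \<alpha>)" .
  have "norm (char_sum (2 * s)) \<le> (\<Sum>\<alpha>\<in>A. norm ((of_nat (card (N \<alpha>)) - of_nat M) * \<psi> \<alpha>))"
    unfolding cs by (rule norm_sum)
  also have "\<dots> = (\<Sum>\<alpha>\<in>A. real M - real (card (N \<alpha>)))"
  proof (rule sum.cong[OF refl])
    fix \<alpha> assume \<alpha>: "\<alpha> \<in> A"
    have "norm (\<psi> \<alpha>) = 1" using \<alpha> norm_\<psi> ext_1 by (auto simp: A_def)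
    moreover have "norm (of_nat (card (N \<alpha>)) - of_nat M :: complex) = real M - real (card (N \<alpha>))"
      using NM[OF \<alpha>] by (metis norm_minus_commute norm_of_nat of_nat_diff)
    ultimately show "norm ((of_nat (card (N \<alpha>)) - of_nat M) * \<psi> \<alpha>) = real M - real (card (N \<alpha>))"
      by (simp add: norm_mult)
  qed
  also have "\<dots> = real (q - 1) * real M - real (\<Sum>\<alpha>\<in>A. card (N \<alpha>))"
    by (simp add: sum_subtractf cardA)
  also have "(\<Sum>\<alpha>\<in>A. card (N \<alpha>)) = card Es'"
    using sum.group[OF finEs' finA img, of "\<lambda>_. 1 :: nat"] by (simp add: NEs')
  also have "real (q - 1) * real M - real (card Es') \<le> real (q - 1) * real M - (real (P * P) - real m)"
  proof -
    have "Es = Es' \<union> {x \<in> Es. poly G x = 0}" by (auto simp: Es'_def)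
    then have "card Es \<le> card Es' + card {x \<in> Es. poly G x = 0}" by (metis card_Un_le)
    also have "card {x \<in> Es. poly G x = 0} \<le> card {x. poly G x = 0}"
      by (intro card_mono poly_roots_finite G_nonzero) auto
    also have "\<dots> \<le> m" unfolding m_def by (rule card_poly_roots_bound[OF G_nonzero])
    finally have "P * P \<le> card Es' + m" using cardEs by simp
    then have "real (P * P) \<le> real (card Es') + real m" by (simp only: of_nat_add[symmetric] of_nat_le_iff)
    then show ?thesis by simp
  qed
  also have "\<dots> \<le> real ((q - 1) * (2 * m + 3) + m) * real P"
  proof -
    \<comment> \<open>The quadratic terms of (q - 1) M and P * P cancel up to 1, leaving a multiple
      of P.\<close>
    have "(q - 1) * c + 1 = P * P" unfolding c_def using P_eq by (simp add: algebra_simps)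
    then have 1: "real (q - 1) * real c + 1 = real (P * P)"
      by (metis of_nat_add of_nat_mult of_nat_1)
    have "real m \<le> real m * real P" using P_eq mult_left_mono[of 1 "real P" "real m"] by simp
    define n where "n = q - 1"
    show ?thesis unfolding M_def n_def[symmetric] using 1[folded n_def] \<open>real m \<le> real m * real P\<close>
      by (simp add: algebra_simps)
  qed
  finally show ?thesis by (simp add: P_def m_def)
qed

text \<open>The numbers \<open>w ^ (2 * e) / q ^ e\<close> have bounded t-th power sums, namely
  minus \<open>char_sum (2 * (e * t))\<close> divided by q^(e t); hence they lie in the unit disc.
  Extension degrees 2 e t are used because \<open>\<rho>\<close> must lie in
  \<open>ext (e * t)\<close>.\<close>

theorem norm_char_sum_le: "norm (char_sum 1) \<le> real (degree G - 1) * sqrt (real q)"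
proof -
  define m where "m = degree G"
  obtain ws where ws: "length ws \<le> m - 1" "\<And>r. r > 0 \<Longrightarrow> char_sum r = - (\<Sum>w\<leftarrow>ws. w ^ r)"
    by (rule power_sums_of_newton_identities[of L_coeff m char_sum, OF L_coeff_0 _ newton_identity])
      (auto simp: m_def L_coeff_eq_0)
  obtain e where e: "e > 0" "\<rho> \<in> ext e"
    by (rule frobenius_period[OF G_polys G_nonzero G_root])
  define C where "C = real ((q - 1) * (2 * m + 3) + m)"
  have le: "norm w \<le> sqrt (real q)" if w: "w \<in> set ws" for w
  proof -
    define us where "us = map (\<lambda>w. w ^ (2 * e) / of_nat q ^ e) ws"
    have bound: "norm (\<Sum>u\<leftarrow>us. u ^ t) \<le> C" if t: "t \<ge> 2 * m + 5" for t
    proof -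
      have t0: "t > 0" using t by simp
      have "\<rho> \<in> ext (e * t)" using e(2) ext_mult_subset by blast
      moreover have "t < q ^ (e * t)"
      proof -
        have "t \<le> e * t" using e(1) by simp
        also have "\<dots> < q ^ (e * t)" using q_gt_1 by (intro power_gt_expt) simp
        finally show ?thesis .
      qed
      then have "q ^ (e * t) > 2 * degree G + 4" using t m_def by linarith
      ultimately have "norm (char_sum (2 * (e * t))) \<le> C * real (q ^ (e * t))"
        unfolding C_def m_def using e(1) t0 by (intro norm_char_sum_even_le) auto
      moreover have "(\<Sum>u\<leftarrow>us. u ^ t) = - char_sum (2 * (e * t)) / of_nat (q ^ (e * t))"
      proof -
        have "(\<Sum>u\<leftarrow>us. u ^ t) = (\<Sum>w\<leftarrow>ws. w ^ (2 * (e * t)) / of_nat (q ^ (e * t)))"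
          by (simp add: us_def o_def power_divide mult.assoc flip: power_mult)
        also have "\<dots> = (\<Sum>w\<leftarrow>ws. w ^ (2 * (e * t))) / of_nat (q ^ (e * t))"
          by (induction ws) (auto simp: add_divide_distrib)
        finally show ?thesis using ws(2)[of "2 * (e * t)"] e(1) t0 by simp
      qed
      ultimately show ?thesis using q_gt_1
        by (simp add: norm_divide norm_power divide_le_eq)
    qed
    have "norm (w ^ (2 * e) / of_nat q ^ e) \<le> 1"
      by (rule norm_le_1_if_power_sums_bounded[OF bound]) (use w in \<open>auto simp: us_def\<close>)
    then have "(norm w ^ 2) ^ e \<le> real q ^ e"
      using q_gt_1 by (simp add: norm_divide norm_power divide_le_eq power_mult)
    then have "norm w ^ 2 \<le> real q"
      using e(1) by (metis power_mono_iff zero_le_power2 of_nat_0_le_iff)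
    then show ?thesis by (rule real_le_rsqrt)
  qed
  have "norm (char_sum 1) = norm (\<Sum>w\<leftarrow>ws. w)" using ws(2)[of 1] by simp
  also have "\<dots> \<le> (\<Sum>w\<leftarrow>ws. norm w)" by (induction ws) (auto intro: order_trans[OF norm_triangle_ineq])
  also have "\<dots> \<le> real (length ws) * sqrt (real q)"
    using le by (induction ws) (auto simp: algebra_simps intro!: add_mono)
  also have "\<dots> \<le> real (m - 1) * sqrt (real q)" using ws(1) by (intro mult_right_mono) auto
  finally show ?thesis by (simp add: m_def)
qed

end

section \<open>Finite fields\<close>

lemma finite_field_power_card_minus_1:
  fixes x :: "'a :: {field, finite}"
  assumes "x \<noteq> 0"
  shows "x ^ (CARD('a) - 1) = 1"
proof -
  have "(\<Prod>y\<in>UNIV - {0}. y) = (\<Prod>y\<in>UNIV - {0}. x * y)"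
    by (rule prod.reindex_bij_witness[of _ "\<lambda>y. x * y" "\<lambda>y. y / x"]) (use assms in auto)
  also have "\<dots> = x ^ (CARD('a) - 1) * (\<Prod>y\<in>UNIV - {0}. y)"
    by (simp add: prod.distrib)
  finally show ?thesis by (simp add: prod_zero_iff)
qed

lemma finite_field_card_gt_1: "CARD('a :: {field, finite}) > 1"
  using card_mono[of UNIV "{0, 1 :: 'a}"] by simp

lemma finite_field_power_card: "x ^ CARD('a) = x" for x :: "'a :: {field, finite}"
proof (cases "x = 0")
  case False
  have "x ^ CARD('a) = x * x ^ (CARD('a) - 1)"
    using finite_field_card_gt_1[where ?'a = 'a] by (cases "CARD('a)") auto
  then show ?thesis using finite_field_power_card_minus_1[OF False] by simp
qed (simp add: power_0_left)

lemma finite_field_prime_CHAR: "prime CHAR('a :: {field, finite})"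
  by (intro prime_CHAR_semidom finite_imp_CHAR_pos) simp

text \<open>The polynomial \<open>(X + 1)^q - X^q - 1\<close> has degree less than \<open>q\<close> and vanishes on the whole field,
  so it is zero; this fails if \<open>q\<close> has a factor prime to the characteristic.\<close>
lemma finite_field_card_eq_CHAR_power:
  "\<exists>a>0. CARD('a :: {field, finite}) = CHAR('a) ^ a"
proof -
  define q p where "q = CARD('a)" and "p = CHAR('a)"
  have p: "prime p" unfolding p_def by (rule finite_field_prime_CHAR)
  have q1: "q > 1" unfolding q_def by (rule finite_field_card_gt_1)
  obtain m where m: "q = p ^ multiplicity p q * m" "\<not> p dvd m"
    using multiplicity_decompose'[of q p] p q1 by (metis not_one_less_zero not_prime_unit)
  define t where "t = p ^ multiplicity p q"
  have t0: "t > 0" using p by (simp add: t_def prime_gt_0_nat)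
  have m0: "m > 0" using m by (cases m) auto
  have "m = 1"
  proof (rule ccontr)
    assume "m \<noteq> 1"
    then have m1: "m > 1" using m0 by simp
    have "t * 1 < t * m" using m1 t0 by (intro mult_strict_left_mono) auto
    then have tq: "t < q" using m(1) by (simp add: t_def)
    define D :: "'a poly" where "D = [:1, 1:] ^ q - monom 1 q - 1"
    have "poly D x = 0" for x
      using finite_field_power_card[of x] finite_field_power_card[of "1 + x"]
      by (simp add: D_def poly_monom q_def)
    then have roots: "{x. poly D x = 0} = UNIV" by auto
    have "degree D < q"
    proof -
      have "degree ([:1, 1:] ^ q - monom 1 q :: 'a poly) < q"
      proof (rule degree_lessI, goal_cases)
        case 2
        have "coeff ([:1, 1:] ^ q - monom 1 q :: 'a poly) k = 0" if "k \<ge> q" for k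
        proof (cases "k = q")
          case True
          have "degree ([:1, 1:] ^ q :: 'a poly) = q" by (simp add: degree_linear_power[of 1])
          moreover have "lead_coeff ([:1, 1:] ^ q :: 'a poly) = 1" by (simp add: lead_coeff_power)
          ultimately show ?thesis using True by simp
        next
          case False
          then have "k > q" using that by simp
          then show ?thesis by (simp add: coeff_eq_0 degree_linear_power[of 1])
        qed
        then show ?case by blast
      qed (use q1 in auto)
      then show ?thesis unfolding D_def by (rule degree_diff_less) (use q1 in auto)
    qed
    then have "D = 0" using card_poly_roots_bound[of D] roots by (auto simp: q_def)
    then have "coeff D t = 0" by simp
    moreover have "coeff D t = coeff ([:1, 1:] ^ q) t"
      unfolding D_def coeff_diff coeff_monom coeff_1 using tq t0 by simp
    ultimately have 1: "coeff ([:1, 1:] ^ q :: 'a poly) t = 0" by simp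
    \<comment> \<open>With q = t * m and t a power of p, (X + 1)^q is (X^t + 1)^m, whose coefficient
      at X^t is m, nonzero in the field.\<close>
    have "[:1, 1:] = monom 1 1 + (1 :: 'a poly)" by (simp add: monom_altdef one_pCons)
    then have "[:1, 1:] ^ t = (monom 1 1 :: 'a poly) ^ t + 1 ^ t"
      using freshmans_dream'[where ?'a = "'a poly" and n = "multiplicity p q" and m = t] p
      by (simp add: p_def t_def)
    then have "([:1, 1:] ^ t) ^ m = (monom 1 t + 1 :: 'a poly) ^ m" by (simp add: monom_power)
    then have "([:1, 1:] :: 'a poly) ^ q = (monom 1 t + 1) ^ m"
      unfolding power_mult[symmetric] t_def m(1)[symmetric] .
    also have "\<dots> = (\<Sum>k\<le>m. of_nat (m choose k) * monom 1 (t * k))"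
      by (subst binomial_ring) (simp add: monom_power)
    finally have "coeff ([:1, 1:] ^ q :: 'a poly) t = (\<Sum>k\<le>m. of_nat (m choose k) * (if t * k = t then 1 else 0))"
      by (simp add: coeff_sum of_nat_poly)
    also have "\<dots> = (\<Sum>k\<in>{1}. of_nat (m choose k) * (if t * k = t then 1 else 0))"
      using m1 t0 by (intro sum.mono_neutral_right) auto
    finally have "coeff ([:1, 1:] ^ q :: 'a poly) t = of_nat m" by simp
    then show False using 1 m(2) by (simp add: of_nat_eq_0_iff_char_dvd p_def)
  qed
  have q_eq: "q = p ^ multiplicity p q" using m(1) unfolding \<open>m = 1\<close> mult_1_right .
  have "multiplicity p q > 0"
  proof (rule ccontr)
    assume "\<not> multiplicity p q > 0"
    then have z: "multiplicity p q = 0" by simp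
    have "q = p ^ 0" using q_eq unfolding z .
    then show False using q1 by simp
  qed
  then show ?thesis using q_eq unfolding q_def p_def by blast
qed

text \<open>The q elements of the field already exhaust the at most q roots of X^q - X in the
  closure.\<close>

lemma frobenius_tower_finite_field:
  "frobenius_tower CARD('a :: {field, finite}) (range (to_ac :: 'a \<Rightarrow> 'a alg_closure))"
proof
  define q where "q = CARD('a)"
  have q1: "q > 1" unfolding q_def by (rule finite_field_card_gt_1)
  show "prime CHAR('a alg_closure)" using finite_field_prime_CHAR by simp
  show "\<exists>a>0. CARD('a) = CHAR('a alg_closure) ^ a"
    using finite_field_card_eq_CHAR_power[where ?'a = 'a] by simp
  define p :: "'a alg_closure poly" where "p = monom 1 q - monom 1 1"
  have "coeff p q = 1" using q1 by (simp add: p_def)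
  then have p0: "p \<noteq> 0" by auto
  have "degree p \<le> q" unfolding p_def using q1 by (intro degree_diff_le) (auto simp: degree_monom_eq)
  moreover have rt: "{x. poly p x = 0} = {x. x ^ CARD('a) = x}"
    by (auto simp: p_def poly_monom q_def)
  ultimately have "card {x :: 'a alg_closure. x ^ CARD('a) = x} \<le> q" "finite {x :: 'a alg_closure. x ^ CARD('a) = x}"
    using card_poly_roots_bound[OF p0] poly_roots_finite[OF p0] by auto
  moreover have "range to_ac \<subseteq> {x :: 'a alg_closure. x ^ CARD('a) = x}"
    by (auto simp: finite_field_power_card simp flip: to_ac_power)
  moreover have "card (range (to_ac :: 'a \<Rightarrow> _)) = q"
    unfolding q_def by (rule card_image[OF inj_to_ac])
  ultimately show "range to_ac = {x :: 'a alg_closure. x ^ CARD('a) = x}"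
    by (intro card_seteq) auto
qed

text \<open>A root \<open>\<rho>\<close> of f(X^e) lying above a nonzero root r of f is simple: by
  the chain rule the derivative there is f'(r) e \<open>\<rho>\<close>^(e - 1), where f'(r) is
  nonzero by the discriminant, and e is prime to the characteristic because it divides q -
  1.\<close>

theorem weil_bound_quadratic_power:
  fixes a b c :: "'a :: {field, finite}" and \<xi> :: "'a \<Rightarrow> complex"
  assumes a: "a \<noteq> 0" and disc: "b\<^sup>2 - 4 * a * c \<noteq> 0"
    and e: "e dvd CARD('a) - 1"
    and \<xi>: "\<And>x y. \<xi> (x * y) = \<xi> x * \<xi> y" "\<xi> 0 = 0" "\<And>x. x \<noteq> 0 \<Longrightarrow> norm (\<xi> x) = 1"
    and nt: "\<exists>x. x \<noteq> 0 \<and> \<xi> x \<noteq> 1"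
  shows "norm (\<Sum>u\<in>UNIV. \<xi> (poly [:c, b, a:] (u ^ e))) \<le> real (2 * e - 1) * sqrt (real CARD('a))"
proof -
  define q where "q = CARD('a)"
  interpret frobenius_tower q "range (to_ac :: 'a \<Rightarrow> 'a alg_closure)"
    unfolding q_def by (rule frobenius_tower_finite_field)
  have e0: "e > 0" using e finite_field_card_gt_1[where ?'a = 'a] by (auto intro!: Nat.gr0I)
  define f where "f = map_poly to_ac [:c, b, a:]"
  have f: "f = [:to_ac c, to_ac b, to_ac a:]" by (simp add: f_def map_poly_pCons)
  define G where "G = pcompose f (monom 1 e)"
  have pG: "poly G x = poly f (x ^ e)" for x by (simp add: G_def poly_pcompose poly_monom)
  have dG: "degree G = 2 * e" using a by (simp add: G_def degree_pcompose f degree_monom_eq)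
  have discK: "to_ac b ^ 2 - 4 * to_ac a * to_ac c \<noteq> 0"
    using disc by (metis to_ac_diff to_ac_power to_ac_mult to_ac_numeral to_ac_eq_0_iff)
  obtain r where r: "poly f r = 0" "r \<noteq> 0"
  proof -
    have "degree f > 0" using a by (simp add: f)
    then obtain x where x: "poly f x = 0" using alg_closed_imp_poly_has_root by blast
    show ?thesis
    proof (cases "x = 0")
      case True
      then have "to_ac c = 0" using x by (simp add: f)
      then have "c = 0" by simp
      then have "b \<noteq> 0" using disc by auto
      then have "poly f (- to_ac b / to_ac a) = 0" "- to_ac b / to_ac a \<noteq> 0"
        using a \<open>c = 0\<close> by (simp_all add: f field_simps)
      then show ?thesis using that by blast
    qed (use that x in blast)
  qed
  \<comment> \<open>The computation never divides by 2, so characteristic 2 is covered.\<close>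
  have deriv_r: "poly (pderiv f) r \<noteq> 0"
  proof
    assume "poly (pderiv f) r = 0"
    then have "to_ac b + 2 * to_ac a * r = 0" by (simp add: f pderiv_pCons algebra_simps)
    then have "to_ac b = - (2 * to_ac a * r)" by (simp add: eq_neg_iff_add_eq_0)
    moreover have "to_ac c = - (to_ac b * r + to_ac a * r ^ 2)"
      using r(1) by (simp add: f eq_neg_iff_add_eq_0 algebra_simps power2_eq_square)
    ultimately have "to_ac b ^ 2 - 4 * to_ac a * to_ac c = 0"
      by (simp add: algebra_simps power2_eq_square)
    then show False using discK by simp
  qed
  obtain \<rho> where \<rho>: "\<rho> ^ e = r" using nth_root_exists[OF e0] by blast
  have of_nat_e: "(of_nat e :: 'a alg_closure) \<noteq> 0"
  proof
    assume "(of_nat e :: 'a alg_closure) = 0"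
    then have "(of_nat (q - 1) :: 'a alg_closure) = 0" using e unfolding q_def
      by (metis dvdE of_nat_mult mult_zero_left)
    then have "(of_nat q :: 'a alg_closure) = 1" using q_gt_1 by (simp add: of_nat_diff)
    then show False using of_nat_q_power[of 1] by simp
  qed
  have "poly (pderiv G) \<rho> = poly (pderiv f) r * (of_nat e * \<rho> ^ (e - 1))"
    by (simp add: G_def pderiv_pcompose poly_pcompose poly_monom \<rho> pderiv_monom)
  also have "\<dots> \<noteq> 0" using deriv_r of_nat_e r(2) \<rho> e0 by (auto simp: power_0_left)
  finally have "poly (pderiv G) \<rho> \<noteq> 0" .
  moreover have "poly G \<rho> = 0" by (simp add: pG \<rho> r)
  ultimately obtain G1 where G1: "G = [:-\<rho>, 1:] * G1" "poly G1 \<rho> \<noteq> 0"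
    using simple_root_decomp by metis
  have F1: "ext 1 = range (to_ac :: 'a \<Rightarrow> _)" by (rule ext_1)
  have fP: "f \<in> polys 1" unfolding f polys_pCons polys_const F1 by auto
  have "G \<in> polys 1"
  proof -
    have "monom 1 e \<in> polys 1" unfolding polys_def coeff_monom by auto
    then have "pcompose h (monom 1 e) \<in> polys 1" if "h \<in> polys 1" for h
      using that
    proof (induction h)
      case (pCons x h)
      then have "x \<in> ext 1" "h \<in> polys 1" by (auto simp only: polys_pCons)
      then show ?case using pCons unfolding pcompose_pCons by (intro polys_closed) (auto simp only: polys_const)
    qed (simp only: pcompose_0 polys_0)
    then show ?thesis unfolding G_def using fP by blast
  qed
  interpret kummer_sum q "range (to_ac :: 'a \<Rightarrow> 'a alg_closure)" G G1 \<rho> "\<lambda>x. \<xi> (of_ac x)"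
  proof
    show "\<xi> (of_ac (x * y)) = \<xi> (of_ac x) * \<xi> (of_ac y)" if "x \<in> range to_ac" "y \<in> range to_ac"
      for x y :: "'a alg_closure"
      using that \<xi>(1) by (auto simp flip: to_ac_mult)
    show "\<exists>x\<in>range to_ac - {0}. \<xi> (of_ac x) \<noteq> 1"
      using nt by (auto intro!: bexI[of _ "to_ac _"])
  qed (use \<open>G \<in> polys 1\<close> G1 \<xi> in auto)
  have "char_sum 1 = (\<Sum>x\<in>range to_ac. \<xi> (of_ac (poly G x)))"
    unfolding char_sum_def F1 by (simp add: base_norm_def)
  also have "\<dots> = (\<Sum>u\<in>UNIV. \<xi> (of_ac (poly G (to_ac u))))"
    by (simp add: sum.reindex[OF inj_to_ac])
  also have "\<dots> = (\<Sum>u\<in>UNIV. \<xi> (poly [:c, b, a:] (u ^ e)))"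
  proof (rule sum.cong[OF refl])
    fix u :: 'a
    have "poly G (to_ac u) = to_ac (poly [:c, b, a:] (u ^ e))"
      by (simp add: pG f)
    then show "\<xi> (of_ac (poly G (to_ac u))) = \<xi> (poly [:c, b, a:] (u ^ e))"
      by (simp only: of_ac_to_ac)
  qed
  finally show ?thesis using norm_char_sum_le by (simp add: dG q_def)
qed

section \<open>The sieve\<close>

text \<open>An exchange argument: M separates the values on S from those on R - S, and M >= 1 takes
  care of surplus elements of R. It reduces a product over an unknown set of primes to one over the
  smallest primes.\<close>

lemma prod_exchange_le:
  fixes g :: "'a \<Rightarrow> real"
  assumes "finite R" "finite S" "card S \<le> card R" "M \<ge> 1"
    and S: "\<And>x. x \<in> S \<Longrightarrow> 0 \<le> g x \<and> g x \<le> M"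
    and R: "\<And>x. x \<in> R - S \<Longrightarrow> M \<le> g x"
  shows "prod g S \<le> prod g R"
proof -
  have card: "card (S - R) \<le> card (R - S)"
    using assms(1-3) by (metis Int_commute card_Diff_subset_Int diff_le_mono finite_Int)
  have "prod g (S - R) \<le> M ^ card (S - R)"
    using prod_mono[of "S - R" g "\<lambda>_. M"] S by (simp add: prod_constant)
  also have "M ^ card (S - R) \<le> M ^ card (R - S)" using card assms(4) by (intro power_increasing)
  also have "M ^ card (R - S) \<le> prod g (R - S)"
    using prod_mono[of "R - S" "\<lambda>_. M" g] R assms(4) by (simp add: prod_constant)
  finally have "prod g (S \<inter> R) * prod g (S - R) \<le> prod g (S \<inter> R) * prod g (R - S)"
    using S by (intro mult_left_mono prod_nonneg) auto
  then show ?thesis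
    using prod.Int_Diff[of S g R] prod.Int_Diff[of R g S] assms(1,2) by (simp add: Int_commute)
qed

lemma sum_exchange_le:
  fixes g :: "'a \<Rightarrow> real"
  assumes "finite R" "finite S" "card R \<le> card S" "M \<ge> 0"
    and S: "\<And>x. x \<in> S \<Longrightarrow> M \<le> g x"
    and R: "\<And>x. x \<in> R - S \<Longrightarrow> g x \<le> M"
  shows "sum g R \<le> sum g S"
proof -
  have card: "card (R - S) \<le> card (S - R)"
    using assms(1-3) by (metis Int_commute card_Diff_subset_Int diff_le_mono finite_Int)
  have "sum g R = sum g (R \<inter> S) + sum g (R - S)"
    using assms(1) by (metis sum.Int_Diff)
  also have "sum g (R - S) \<le> real (card (R - S)) * M" using R by (intro sum_bounded_above) auto
  also have "\<dots> \<le> real (card (S - R)) * M" using card assms(4) by (intro mult_right_mono) auto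
  also have "\<dots> \<le> sum g (S - R)" using S by (intro sum_bounded_below) auto
  also have "sum g (R \<inter> S) + sum g (S - R) = sum g S"
    using assms(2) by (metis sum.Int_Diff Int_commute)
  finally show ?thesis by simp
qed

lemma prime_less_44:
  fixes p :: nat
  assumes "prime p" "p < 44"
  shows "p \<in> {2, 3, 5, 7, 11, 13, 17, 19, 23, 29, 31, 37, 41, 43}"
proof (rule ccontr)
  assume n: "p \<notin> {2, 3, 5, 7, 11, 13, 17, 19, 23, 29, 31, 37, 41, 43}"
  have "\<not> d dvd p" if "d \<in> {2, 3, 5}" for d
    using that n assms(1) by (auto simp: prime_nat_iff)
  then have "\<not> 2 dvd p" "\<not> 3 dvd p" "\<not> 5 dvd p" by auto
  then have "p = 1" using n assms(2) by simp presburger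
  then show False using assms(1) by simp
qed

text \<open>145/128 = 1 + 1/8 + 1/128 is the quadratic Taylor bound for exp (1/8). Its 24th power
  bounds exp 3 from below by 159/8, and its 159th power gives the claim.\<close>

lemma exp_exp_3_gt: "exp (exp 3) > (300000000 :: real)"
proof -
  have e8: "145 / 128 \<le> exp (1 / 8 :: real)"
    using exp_lower_Taylor_quadratic[of "1 / 8 :: real"] by (simp add: power2_eq_square)
  have pw: "(145 / 128) ^ n \<le> exp (real n / 8)" for n
  proof -
    have "(145 / 128) ^ n \<le> exp (1 / 8 :: real) ^ n" using e8 by (intro power_mono) auto
    then show ?thesis by (simp flip: exp_of_nat_mult)
  qed
  have "159 / 8 \<le> (145 / 128 :: real) ^ 24" by (simp add: power_divide)
  also have "\<dots> \<le> exp 3" using pw[of 24] by simp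
  finally have 1: "exp (159 / 8) \<le> exp (exp 3 :: real)" by simp
  have "(300000000 :: real) < (145 / 128) ^ 159" by (simp add: power_divide)
  also have "\<dots> \<le> exp (159 / 8)" using pw[of 159] by simp
  also note 1
  finally show ?thesis .
qed

text \<open>Primes are added one at a time: the t not divisible by p are all t less those counted
  with \<open>e * p\<close> in place of e. The main terms combine to the factor 1 - 1/p, and the two
  errors add up, doubling the bound.\<close>

lemma sieve_fundamental:
  fixes N :: nat and w :: "nat \<Rightarrow> real" and k B :: real
  assumes N: "N > 0"
    and approx: "\<And>e. e dvd N \<Longrightarrow> \<bar>k * (\<Sum>t | t < N \<and> e dvd t. w t) - real N / real e\<bar> \<le> B"
    and C: "finite C" "\<And>p. p \<in> C \<Longrightarrow> prime p"
    and e: "e * \<Prod>C dvd N" "\<And>p. p \<in> C \<Longrightarrow> \<not> p dvd e"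
  shows "\<bar>k * (\<Sum>t | t < N \<and> e dvd t \<and> (\<forall>p\<in>C. \<not> p dvd t). w t)
    - real N / real e * (\<Prod>p\<in>C. 1 - 1 / real p)\<bar> \<le> 2 ^ card C * B"
  using C e
proof (induction C arbitrary: e)
  case empty
  then show ?case using approx[of e] by simp
next
  case (insert p C)
  have p: "prime p" "\<not> p dvd e" using insert by auto
  define W where "W = (\<lambda>C e. \<Sum>t | t < N \<and> e dvd t \<and> (\<forall>p\<in>C. \<not> p dvd t). w t)"
  have split: "W C e = W (insert p C) e + W C (e * p)"
  proof -
    have cop: "coprime e p" using p by (metis coprime_commute prime_imp_coprime)
    have iff: "e * p dvd t \<longleftrightarrow> e dvd t \<and> p dvd t" for t
      using cop by (metis divides_mult dvd_mult_left dvd_mult_right)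
    have "{t. t < N \<and> e dvd t \<and> (\<forall>p\<in>C. \<not> p dvd t)} =
      {t. t < N \<and> e dvd t \<and> (\<forall>p\<in>insert p C. \<not> p dvd t)} \<union>
      {t. t < N \<and> e * p dvd t \<and> (\<forall>p\<in>C. \<not> p dvd t)}" by (auto simp: iff)
    then show ?thesis unfolding W_def by (simp only:) (rule sum.union_disjoint; auto simp: iff)
  qed
  have d1: "e * \<Prod>C dvd N"
    using insert by (metis dvd_mult_right mult.left_commute prod.insert)
  have 1: "\<bar>k * W C e - real N / real e * (\<Prod>p\<in>C. 1 - 1 / real p)\<bar> \<le> 2 ^ card C * B"
    unfolding W_def using insert d1 by (intro insert.IH) auto
  have ndvd: "\<not> r dvd e * p" if "r \<in> C" for r
  proof
    assume "r dvd e * p"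
    moreover have "prime r" "\<not> r dvd e" "r \<noteq> p" using that insert by auto
    ultimately show False using p(1) by (metis prime_dvd_mult_iff primes_dvd_imp_eq)
  qed
  have 2: "\<bar>k * W C (e * p) - real N / real (e * p) * (\<Prod>p\<in>C. 1 - 1 / real p)\<bar> \<le> 2 ^ card C * B"
    unfolding W_def using insert ndvd by (intro insert.IH) (auto simp: mult.assoc)
  define \<theta> where "\<theta> = (\<Prod>p\<in>C. 1 - 1 / real p)"
  have "k * W (insert p C) e - real N / real e * ((1 - 1 / real p) * \<theta>)
    = (k * W C e - real N / real e * \<theta>) - (k * W C (e * p) - real N / real (e * p) * \<theta>)"
    by (simp add: split algebra_simps)
  then have "\<bar>k * W (insert p C) e - real N / real e * ((1 - 1 / real p) * \<theta>)\<bar> \<le> 2 ^ card C * B + 2 ^ card C * B"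
    using order_trans[OF abs_triangle_ineq4 add_mono[OF 1 2]] by (simp only: \<theta>_def)
  then show ?case using insert.hyps by (simp add: W_def \<theta>_def mult_ac)
qed

text \<open>In the application B is 2 k sqrt q, and \<open>B ^ 3 < real q ^ 2\<close> is the
  condition (2k)^6 < q.\<close>

lemma sieve_positive:
  fixes N q :: nat and w :: "nat \<Rightarrow> real" and k B :: real
  assumes q: "q > 300000000" and N: "N = q - 1" and k: "k > 0"
    and w: "\<And>t. w t \<ge> 0"
    and B: "B \<ge> 0" "B ^ 3 < real q ^ 2"
    and approx: "\<And>e. e dvd N \<Longrightarrow> \<bar>k * (\<Sum>t | t < N \<and> e dvd t. w t) - real N / real e\<bar> \<le> B"
  shows "\<exists>t<N. w t > 0 \<and> coprime t N"
proof -
  define PS where "PS = prime_factors N"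
  define C R where "C = PS \<inter> {2, 3}" and "R = PS - {2, 3}"
  have N0: "N > 0" using q N by simp
  have finPS: "finite PS" and finR: "finite R" and finC: "finite C" by (simp_all add: PS_def C_def R_def)
  have prime_PS: "prime p" if "p \<in> PS" for p
    using that unfolding PS_def by (rule in_prime_factors_imp_prime)
  have dvd_PS: "\<Prod>A dvd N" if "A \<subseteq> PS" for A
  proof -
    have "\<Prod>A dvd \<Prod>PS" using that finPS by (intro prod_dvd_prod_subset)
    also have "\<Prod>PS dvd (\<Prod>p\<in>PS. p ^ multiplicity p N)"
      using N0 by (intro prod_dvd_prod dvd_power) (auto simp: PS_def prime_factors_multiplicity)
    also have "\<dots> = N" unfolding PS_def using N0 by (intro prime_factorization_nat[symmetric])
    finally show ?thesis .
  qed
  define W where "W = (\<lambda>C e. \<Sum>t | t < N \<and> e dvd t \<and> (\<forall>p\<in>C. \<not> p dvd t). w t)"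
  define \<theta> where "\<theta> = (\<lambda>A. \<Prod>p\<in>A. 1 - 1 / real p)"
  have fund: "\<bar>k * W A e - real N / real e * \<theta> A\<bar> \<le> 2 ^ card A * B"
    if "A \<subseteq> PS" "e * \<Prod>A dvd N" "\<And>p. p \<in> A \<Longrightarrow> \<not> p dvd e" for A e
    unfolding W_def \<theta>_def using that finPS prime_PS
    by (intro sieve_fundamental N0 approx) (auto intro: finite_subset)
  have not_dvd_1: "\<not> p dvd 1" if "p \<in> PS" for p using prime_PS[OF that] by auto
  have p_ge: "p \<ge> 44 \<or> p \<in> {5, 7, 11, 13, 17, 19, 23, 29, 31, 37, 41, 43}" if "p \<in> R" for p
    using that prime_less_44[of p] prime_PS[of p] by (auto simp: R_def)
  have C_cases: "C = {} \<or> C = {2} \<or> C = {3} \<or> C = {2, 3}"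
    by (cases "2 \<in> PS"; cases "3 \<in> PS") (auto simp: C_def)
  have "k * W PS 1 > 0"
  proof (cases "card R \<le> 11")
    case True
    \<comment> \<open>Union bound: a t divisible by no prime of C but by some prime of PS lies in
      \<open>U p\<close> for some p in R.\<close>
    have WR: "W PS 1 \<ge> W C 1 - (\<Sum>p\<in>R. W C p)"
    proof -
      define T where "T = {t. t < N \<and> (\<forall>p\<in>C. \<not> p dvd t)}"
      define U where "U = (\<lambda>p. {t. t < N \<and> p dvd t \<and> (\<forall>p\<in>C. \<not> p dvd t)})"
      have "T \<subseteq> {t. t < N \<and> 1 dvd t \<and> (\<forall>p\<in>PS. \<not> p dvd t)} \<union> (\<Union>p\<in>R. U p)"
        by (auto simp: T_def U_def C_def R_def)
      then have "sum w T \<le> sum w ({t. t < N \<and> 1 dvd t \<and> (\<forall>p\<in>PS. \<not> p dvd t)} \<union> (\<Union>p\<in>R. U p))"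
        using w finR by (intro sum_mono2) (auto simp: U_def)
      also have "\<dots> \<le> W PS 1 + sum w (\<Union>p\<in>R. U p)"
        unfolding W_def using w finR by (subst sum.union_inter_neutral[symmetric, of _ _ w] sum_Un; auto simp: U_def sum_nonneg)
      also have "sum w (\<Union>p\<in>R. U p) \<le> (\<Sum>p\<in>R. sum w (U p))"
        using finR
      proof (induction R)
        case (insert p R)
        have "sum w (U p \<union> \<Union> (U ` R)) \<le> sum w (U p) + sum w (\<Union> (U ` R))"
          using insert w by (subst sum_Un) (auto simp: U_def sum_nonneg)
        then show ?case using insert by simp
      qed simp
      finally show ?thesis by (simp add: W_def T_def U_def)
    qed
    have c1: "k * W C 1 \<ge> real N * \<theta> C - 2 ^ card C * B"
      using fund[of C 1] dvd_PS[of C] not_dvd_1 by (auto simp: C_def abs_le_iff)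
    have c2: "k * W C p \<le> real N * \<theta> C * (1 / real p) + 2 ^ card C * B" if "p \<in> R" for p
    proof -
      have pr: "prime p" "p \<in> PS" "p \<notin> C" "p \<notin> {2, 3}" using that prime_PS by (auto simp: R_def C_def)
      have "p * \<Prod>C = \<Prod>(insert p C)" using pr finC by simp
      then have "p * \<Prod>C dvd N" using dvd_PS[of "insert p C"] pr by (auto simp: C_def)
      moreover have "\<not> r dvd p" if "r \<in> C" for r
        using that pr prime_PS[of r] primes_dvd_imp_eq[of r p] by (auto simp: C_def)
      ultimately show ?thesis using fund[of C p] by (auto simp: C_def abs_le_iff)
    qed
    have "(\<Sum>p\<in>R. k * W C p) \<le> (\<Sum>p\<in>R. real N * \<theta> C * (1 / real p) + 2 ^ card C * B)"
      by (intro sum_mono c2)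
    also have "\<dots> = real N * \<theta> C * (\<Sum>p\<in>R. 1 / real p) + real (card R) * (2 ^ card C * B)"
      by (simp add: sum.distrib sum_distrib_left)
    finally have main: "k * W PS 1 \<ge> real N * \<theta> C * (1 - (\<Sum>p\<in>R. 1 / real p)) - real (1 + card R) * 2 ^ card C * B"
      using c1 mult_left_mono[OF WR, of k] k
      by (simp add: sum_distrib_left algebra_simps)
    \<comment> \<open>The eleven smallest primes above 3 are the worst case; 1/42 separates 1/41
      from the reciprocals of the later primes.\<close>
    define S :: "nat set" where "S = {5, 7, 11, 13, 17, 19, 23, 29, 31, 37, 41}"
    have "(\<Sum>p\<in>R. 1 / real p) \<le> (\<Sum>p\<in>S. 1 / real p)"
    proof (rule sum_exchange_le[where M = "1 / 42"])
      show "1 / real p \<le> 1 / 42" if "p \<in> R - S" for p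
        using p_ge[of p] that by (intro divide_left_mono) (auto simp: S_def)
    qed (use True finR in \<open>auto simp: S_def\<close>)
    also have "\<dots> \<le> 784 / 1000" by (simp add: S_def)
    finally have sumR: "(\<Sum>p\<in>R. 1 / real p) \<le> 784 / 1000" .
    \<comment> \<open>The worst case is C = {2, 3}, where equality holds.\<close>
    have \<theta>C: "\<theta> C \<ge> 2 ^ card C / 12"
    proof -
      from C_cases show ?thesis by (auto simp: \<theta>_def)
    qed
    \<comment> \<open>667 exceeds 12 * 12 / (216/1000): one 12 bounds \<open>1 + card R\<close>, the
      other comes from \<open>\<theta>C\<close>, and 216/1000 is 1 - 784/1000.\<close>
    have "(667 * B) ^ 3 < real N ^ 3"
    proof -
      have "(667 * B) ^ 3 = 667 ^ 3 * B ^ 3" by (simp add: power_mult_distrib)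
      also have "\<dots> < 667 ^ 3 * real q ^ 2" using B(2) by simp
      also have "\<dots> \<le> (real q - 3) * real q ^ 2" using q by (intro mult_right_mono) auto
      also have "\<dots> \<le> (real q - 1) ^ 3"
        using q by (simp add: power2_eq_square power3_eq_cube algebra_simps)
      also have "\<dots> = real N ^ 3" using q N by (simp add: of_nat_diff)
      finally show ?thesis .
    qed
    then have NB: "667 * B < real N" by (rule power_less_imp_less_base) simp
    have "real (1 + card R) * 2 ^ card C * B \<le> 12 * 2 ^ card C * B"
      using True B by (intro mult_right_mono) auto
    also have "\<dots> < 2 ^ card C / 12 * (216 / 1000 * real N)"
      using NB B(1) by (simp add: field_simps)
    also have "\<dots> \<le> \<theta> C * ((1 - (\<Sum>p\<in>R. 1 / real p)) * real N)"
      using \<theta>C sumR order_trans[OF _ \<theta>C, of 0] by (intro mult_mono mult_right_mono) auto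
    finally show ?thesis using main by (simp add: algebra_simps)
  next
    case False
    \<comment> \<open>Wanted is 2^card PS * B < N * \<open>\<theta> PS\<close>. After cubing, B^3 <
      q^2 <= 4 N^2 reduces this to 4 * 8^card PS < N * \<open>\<theta> PS ^ 3\<close>. As N is at
      least the product of PS, it suffices that the product of the numbers g p = p (1 - 1/p)^3 / 8
      exceeds 4.\<close>
    define g where "g = (\<lambda>p :: nat. (real p - 1) ^ 3 / (8 * real p ^ 2))"
    \<comment> \<open>The twelve smallest primes above 3 are the worst case, and 501/100 lies
      between g 43 and g 44. The primes 2 and 3 cost at most a factor 32 * 9 = 288, and 2400/288 >
      4.\<close>
    define S :: "nat set" where "S = {5, 7, 11, 13, 17, 19, 23, 29, 31, 37, 41, 43}"
    have g_large: "501 / 100 \<le> g p" if "p \<ge> 44" for p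
    proof -
      have p: "real p \<ge> 44" using that by simp
      have "501 / 100 * (8 * real p ^ 2) \<le> 41 * real p ^ 2" using p by simp
      also have "\<dots> \<le> (real p - 3) * real p ^ 2" using p by (intro mult_right_mono) auto
      also have "\<dots> \<le> (real p - 1) ^ 3" using p by (simp add: power2_eq_square power3_eq_cube algebra_simps)
      finally show ?thesis using p by (simp add: g_def pos_le_divide_eq)
    qed
    have "prod g S \<le> prod g R"
    proof (rule prod_exchange_le[where M = "501 / 100"])
      show "501 / 100 \<le> g p" if "p \<in> R - S" for p
        using p_ge[of p] that by (intro g_large) (auto simp: S_def)
    qed (use False finR in \<open>auto simp: S_def g_def\<close>)
    moreover have "prod g S > 2400" by (simp add: S_def g_def)
    ultimately have gR: "prod g R > 2400" by simp
    from C_cases have gC: "prod g C \<ge> 1 / 288" by (auto simp: g_def)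
    have "prod g PS = prod g C * prod g R"
      unfolding C_def R_def using finPS by (rule prod.Int_Diff)
    also have "\<dots> \<ge> 1 / 288 * 2400" using gC gR by (intro mult_mono) auto
    finally have gPS: "prod g PS > 4" by simp
    have th0: "\<theta> PS > 0"
      unfolding \<theta>_def
    proof (rule prod_pos)
      show "0 < 1 - 1 / real p" if "p \<in> PS" for p
        using prime_gt_1_nat[OF prime_PS[OF that]] by simp
    qed
    have "prod g PS = real (\<Prod>PS) * (\<theta> PS ^ 3 / 8 ^ card PS)"
    proof -
      have "g p = real p * ((1 - 1 / real p) ^ 3 * (1 / 8))" if "p \<in> PS" for p
        using prime_PS[OF that] prime_gt_0_nat[of p]
        by (simp add: g_def field_simps power2_eq_square power3_eq_cube)
      then have "prod g PS = (\<Prod>p\<in>PS. real p * ((1 - 1 / real p) ^ 3 * (1 / 8)))"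
        by (intro prod.cong refl)
      also have "\<dots> = real (\<Prod>PS) * (\<theta> PS ^ 3 * (1 / 8) ^ card PS)"
        by (simp only: prod.distrib prod_constant of_nat_prod \<theta>_def prod_power_distrib)
      finally show ?thesis by (simp add: power_divide)
    qed
    also have "\<dots> \<le> real N * (\<theta> PS ^ 3 / 8 ^ card PS)"
    proof (rule mult_right_mono)
      have "\<Prod>PS \<le> N" using dvd_PS[of PS] N0 by (intro dvd_imp_le) auto
      then show "real (\<Prod>PS) \<le> real N" by (simp only: of_nat_le_iff)
    qed (use th0 in simp)
    finally have "4 < real N * \<theta> PS ^ 3 / 8 ^ card PS" using gPS by simp
    then have 4: "4 * 8 ^ card PS < real N * \<theta> PS ^ 3" by (simp add: pos_less_divide_eq)
    have "(2 ^ card PS * B) ^ 3 = 8 ^ card PS * B ^ 3"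
    proof -
      have "((2 :: real) ^ card PS) ^ 3 = (2 ^ 3) ^ card PS" by (metis power_mult mult.commute)
      then show ?thesis by (simp add: power_mult_distrib)
    qed
    also have "\<dots> < 8 ^ card PS * real q ^ 2" using B(2) by simp
    also have "\<dots> \<le> 8 ^ card PS * (4 * real N ^ 2)"
    proof -
      have "real q ^ 2 \<le> (2 * real N) ^ 2" using q N by (intro power_mono) auto
      then show ?thesis by (simp add: power_mult_distrib)
    qed
    also have "\<dots> = 4 * 8 ^ card PS * real N ^ 2" by simp
    also have "\<dots> \<le> real N * \<theta> PS ^ 3 * real N ^ 2" using 4 by (intro mult_right_mono) auto
    also have "\<dots> = (real N * \<theta> PS) ^ 3" by (simp add: power2_eq_square power3_eq_cube)
    finally have "2 ^ card PS * B < real N * \<theta> PS"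
      by (rule power_less_imp_less_base) (use th0 in simp)
    then show ?thesis using fund[of PS 1] dvd_PS[of PS] not_dvd_1 by (auto simp: abs_le_iff)
  qed
  then have "W PS 1 > 0" using k by (simp add: zero_less_mult_iff)
  then have "\<exists>t\<in>{t. t < N \<and> 1 dvd t \<and> (\<forall>p\<in>PS. \<not> p dvd t)}. w t > 0"
    unfolding W_def by (meson not_less sum_nonpos)
  then obtain t where t: "t < N" "\<forall>p\<in>PS. \<not> p dvd t" "w t > 0" by auto
  have "coprime t N"
  proof (rule ccontr)
    assume "\<not> coprime t N"
    then obtain p where "prime p" "p dvd t" "p dvd N" 
      by (metis coprime_iff_gcd_eq_1 gcd_dvd1 gcd_dvd2 dvd_trans prime_factor_nat)
    then show False using t(2) N0 by (auto simp: PS_def in_prime_factors_iff)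
  qed
  then show ?thesis using t by blast
qed

section \<open>Primitive elements at which a quadratic is a power\<close>

lemma finite_field_generator:
  "\<exists>g :: 'a :: {field, finite}. g \<noteq> 0 \<and> (\<forall>x. x \<noteq> 0 \<longrightarrow> (\<exists>t<CARD('a) - 1. x = g ^ t)) \<and>
    inj_on (\<lambda>t. g ^ t) {..<CARD('a) - 1}"
proof -
  define R where "R = (ring_of_type_algebra :: 'a ring)"
  interpret R: Ring.field R unfolding R_def by (rule field_from_type_algebra)
  have simps: "carrier R = UNIV" "x \<otimes>\<^bsub>R\<^esub> y = x * y" "\<one>\<^bsub>R\<^esub> = 1" "\<zero>\<^bsub>R\<^esub> = 0" for x y
    by (simp_all add: R_def ring_of_type_algebra_def)
  have pow: "x [^]\<^bsub>R\<^esub> (n :: nat) = x ^ n" for x n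
    by (induction n) (simp_all add: simps mult.commute)
  obtain g where g: "g \<in> carrier (Multiplicative_Group.mult_of R)"
    "carrier (Multiplicative_Group.mult_of R) = {g [^]\<^bsub>R\<^esub> i | i::nat . i \<in> UNIV}"
    using R.finite_field_mult_group_has_gen by (auto simp: simps)
  have car: "carrier (Multiplicative_Group.mult_of R) = UNIV - {0}" by (simp add: simps)
  have g0: "g \<noteq> 0" using g(1) unfolding car by simp
  have all: "\<exists>i :: nat. x = g ^ i" if "x \<noteq> 0" for x using that g(2) unfolding car pow by auto
  define N where "N = CARD('a) - 1"
  have N0: "N > 0" using finite_field_card_gt_1[where ?'a = 'a] by (simp add: N_def)
  have gN: "g ^ N = 1"
    unfolding N_def by (rule finite_field_power_card_minus_1[OF g0])
  have red: "g ^ i = g ^ (i mod N)" for i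
  proof -
    have "g ^ i = g ^ (N * (i div N) + i mod N)" by simp
    also have "\<dots> = g ^ (i mod N)" unfolding power_add power_mult gN by simp
    finally show ?thesis .
  qed
  have ex: "\<exists>t<N. x = g ^ t" if "x \<noteq> 0" for x using all[OF that] red N0 by (metis mod_less_divisor)
  then have "(\<lambda>t. g ^ t) ` {..<N} = UNIV - {0}" using g0 by force
  moreover have "card (UNIV - {0 :: 'a}) = N" by (simp add: N_def)
  ultimately have "inj_on (\<lambda>t. g ^ t) {..<N}" by (intro eq_card_imp_inj_on) auto
  then show ?thesis using g0 ex unfolding N_def by blast
qed

lemma sum_periodic:
  fixes F :: "nat \<Rightarrow> 'b :: comm_ring_1"
  assumes "\<And>s. F (s + m) = F s"
  shows "(\<Sum>t<e * m. F t) = of_nat e * (\<Sum>s<m. F s)"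
proof (induction e)
  case (Suc e)
  have per: "F (s + e * m) = F s" for s
    by (induction e) (simp_all add: assms add.assoc[symmetric] add.commute[of m])
  have "(\<Sum>t<Suc e * m. F t) = (\<Sum>t<e * m. F t) + (\<Sum>s<m. F (s + e * m))"
    by (simp add: sum.lessThan_Suc lessThan_atLeast0 sum.shift_bounds_nat_ivl[of F 0 "e * m" m, simplified]
      sum.atLeastLessThan_concat[of 0 "e * m" "m + e * m" F, symmetric])
  then show ?case using Suc by (simp add: per algebra_simps)
qed simp

text \<open>Through the generator g, e-th powers become exponents divisible by e, and primitive
  elements become exponents coprime to N.\<close>

locale quadratic_kth_power =
  fixes a b c g :: "'a :: {field, finite}" and N k :: nat
  assumes a: "a \<noteq> 0" and disc: "b\<^sup>2 - 4 * a * c \<noteq> 0"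
    and N: "N = CARD('a) - 1"
    and k: "k \<ge> 2" "k dvd N"
    and g: "g \<noteq> 0" "\<And>x. x \<noteq> 0 \<Longrightarrow> \<exists>t<N. x = g ^ t" "inj_on (\<lambda>t. g ^ t) {..<N}"
begin

lemma N_pos: "N > 0"
  using finite_field_card_gt_1[where ?'a = 'a] by (simp add: N)

lemma g_power_N: "g ^ N = 1"
  unfolding N by (rule finite_field_power_card_minus_1[OF g(1)])

lemma g_power_mod: "g ^ (i mod N) = g ^ i"
proof -
  have "g ^ i = g ^ (N * (i div N) + i mod N)" by simp
  also have "\<dots> = g ^ (i mod N)" unfolding power_add power_mult g_power_N by simp
  finally show ?thesis ..
qed

lemma g_power_eq_iff: "g ^ i = g ^ j \<longleftrightarrow> [i = j] (mod N)"
  using inj_onD[OF g(3), of "i mod N" "j mod N"] g_power_mod[of i] g_power_mod[of j] N_pos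
  unfolding Cong.cong_def by (metis lessThan_iff mod_less_divisor)

text \<open>Any exponent serves: it is determined modulo N, hence modulo the divisor k of N, which
  is all that \<open>\<zeta>\<close> sees.\<close>

definition dlog :: "'a \<Rightarrow> nat" where "dlog x = (SOME t. x = g ^ t)"

lemma g_power_dlog: "x \<noteq> 0 \<Longrightarrow> g ^ dlog x = x"
  unfolding dlog_def using g(2)[of x] by (metis (mono_tags, lifting) someI_ex)

lemma dlog_cong: "[dlog (g ^ i) = i] (mod k)"
proof -
  have "g ^ dlog (g ^ i) = g ^ i" using g(1) by (intro g_power_dlog) simp
  then show ?thesis using k(2) unfolding g_power_eq_iff by (rule cong_dvd_modulus_nat)
qed

lemma dlog_mult_cong: "x \<noteq> 0 \<Longrightarrow> y \<noteq> 0 \<Longrightarrow> [dlog (x * y) = dlog x + dlog y] (mod k)"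
  using dlog_cong[of "dlog x + dlog y"] by (simp add: power_add g_power_dlog)

definition \<zeta> :: "nat \<Rightarrow> complex" where
  "\<zeta> i = exp (2 * of_real pi * \<i> * of_nat i / of_nat k)"

lemma \<zeta>_eq_iff: "\<zeta> i = \<zeta> j \<longleftrightarrow> [i = j] (mod k)"
  unfolding \<zeta>_def using k(1) complex_root_unity_eq[of k i j] by (simp add: Cong.cong_def)

lemma \<zeta>_add: "\<zeta> (i + j) = \<zeta> i * \<zeta> j"
  by (simp add: \<zeta>_def exp_add[symmetric] add_divide_distrib[symmetric] algebra_simps)

lemma \<zeta>_mult: "\<zeta> (i * j) = \<zeta> j ^ i"
  by (induction i) (simp_all add: \<zeta>_add, simp add: \<zeta>_def)

lemma norm_\<zeta>: "norm (\<zeta> i) = 1"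
  by (simp add: \<zeta>_def norm_exp_eq_Re)

text \<open>For j < k these are the characters of order dividing k. The value 0 at 0, also for j =
  0, makes \<open>sum_kchar\<close> correct at 0.\<close>

definition kchar :: "nat \<Rightarrow> 'a \<Rightarrow> complex" where
  "kchar j x = (if x = 0 then 0 else \<zeta> (j * dlog x))"

lemma kchar_mult: "kchar j (x * y) = kchar j x * kchar j y"
proof (cases "x = 0 \<or> y = 0")
  case False
  then have "[j * dlog (x * y) = j * dlog x + j * dlog y] (mod k)"
    using cong_mult[OF cong_refl dlog_mult_cong] by (simp add: algebra_simps)
  then have "\<zeta> (j * dlog (x * y)) = \<zeta> (j * dlog x + j * dlog y)" by (simp only: \<zeta>_eq_iff)
  then show ?thesis using False by (simp add: kchar_def \<zeta>_add)
qed (auto simp: kchar_def)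

lemma norm_kchar: "x \<noteq> 0 \<Longrightarrow> norm (kchar j x) = 1"
  by (simp add: kchar_def norm_\<zeta>)

lemma kth_power_iff:
  assumes "x \<noteq> 0"
  shows "x \<in> nonzero_kth_powers k \<longleftrightarrow> k dvd dlog x"
proof
  assume "x \<in> nonzero_kth_powers k"
  then obtain y where y: "x = y ^ k" "y \<noteq> 0" by (auto simp: nonzero_kth_powers_def)
  have "x = g ^ (dlog y * k)" using y by (simp add: power_mult g_power_dlog)
  then have "[dlog x = dlog y * k] (mod k)" using dlog_cong by metis
  then show "k dvd dlog x" by (simp add: Cong.cong_def dvd_eq_mod_eq_0)
next
  assume "k dvd dlog x"
  then obtain i where "dlog x = k * i" by (auto elim: dvdE)
  then have "x = (g ^ i) ^ k" using g_power_dlog[OF assms] by (metis power_mult mult.commute)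
  then show "x \<in> nonzero_kth_powers k" using g(1) by (auto simp: nonzero_kth_powers_def)
qed

lemma sum_kchar: "(\<Sum>j<k. kchar j x) = (if x \<in> nonzero_kth_powers k then of_nat k else 0)"
proof (cases "x = 0")
  case True
  then show ?thesis using k by (auto simp: kchar_def nonzero_kth_powers_def)
next
  case False
  define z where "z = \<zeta> (dlog x)"
  have z1: "z = 1 \<longleftrightarrow> k dvd dlog x"
    using \<zeta>_eq_iff[of "dlog x" 0] by (simp add: z_def Cong.cong_def dvd_eq_mod_eq_0) (simp add: \<zeta>_def)
  have "(\<Sum>j<k. kchar j x) = (\<Sum>j<k. z ^ j)" using False by (simp add: kchar_def \<zeta>_mult z_def)
  also have "\<dots> = (if z = 1 then of_nat k else 0)"
  proof (cases "z = 1")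
    case z: False
    have "z ^ k = \<zeta> 0"
      unfolding z_def \<zeta>_mult[symmetric] \<zeta>_eq_iff by (simp add: Cong.cong_def)
    then have "z ^ k = 1" by (simp add: \<zeta>_def)
    then show ?thesis using z by (simp add: geometric_sum)
  qed simp
  finally show ?thesis using kth_power_iff[OF False] z1 by simp
qed

definition f :: "'a \<Rightarrow> 'a" where "f x = poly [:c, b, a:] x"

definition weight :: "nat \<Rightarrow> real" where
  "weight t = (if f (g ^ t) \<in> nonzero_kth_powers k then 1 else 0)"

lemma sum_UNIV_eq:
  fixes F :: "'a \<Rightarrow> 'b :: comm_ring_1"
  shows "sum F UNIV = F 0 + (\<Sum>t<N. F (g ^ t))"
proof -
  have "(\<lambda>t. g ^ t) ` {..<N} = UNIV - {0}" using g by force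
  then have "(\<Sum>t<N. F (g ^ t)) = sum F (UNIV - {0})" using sum.reindex[OF g(3), of F] by simp
  then show ?thesis by (simp add: sum.remove[of UNIV 0])
qed

text \<open>After multiplication by e, orthogonality of characters leaves sums over all u <> 0 of
  \<open>kchar j (f (u ^ e))\<close>. The one for j = 0 misses N by the at most 2 e zeros of f(u^e),
  and each of the k - 1 others is at most 2 e sqrt q.\<close>

lemma weight_sum_approx:
  assumes e: "e dvd N"
  shows "\<bar>real k * (\<Sum>t | t < N \<and> e dvd t. weight t) - real N / real e\<bar> \<le> 2 * real k * sqrt (real CARD('a))"
proof -
  define sq where "sq = sqrt (real CARD('a))"
  have sq1: "sq \<ge> 1" by (simp add: sq_def Suc_le_eq)
  obtain m where m: "N = e * m" using e by (auto elim: dvdE)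
  have e0: "e > 0" using m N_pos by (cases e) auto
  have "{t. t < N \<and> e dvd t} = (\<lambda>s. e * s) ` {..<m}"
    using e0 by (auto simp: m elim!: dvdE)
  then have A: "(\<Sum>t | t < N \<and> e dvd t. weight t) = (\<Sum>s<m. weight (e * s))"
    using e0 by (simp add: sum.reindex inj_on_def)
  have per: "g ^ (e * (s + m)) = g ^ (e * s)" for s
    by (simp add: distrib_left power_add g_power_N flip: m)
  have blocks: "(\<Sum>t<N. F (g ^ (e * t))) = of_nat e * (\<Sum>s<m. F (g ^ (e * s)))" for F :: "'a \<Rightarrow> complex"
    using sum_periodic[of "\<lambda>s. F (g ^ (e * s))" m e] per by (simp add: m)
  define D where "D = (\<lambda>j. \<Sum>t<N. kchar j (f (g ^ (e * t))))"
  have "of_nat e * (of_nat k * (\<Sum>s<m. of_real (weight (e * s)))) =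
    of_nat e * (\<Sum>s<m. \<Sum>j<k. kchar j (f (g ^ (e * s))))"
    by (simp add: sum_kchar sum_distrib_left weight_def if_distrib cong: if_cong)
  also have "\<dots> = (\<Sum>t<N. \<Sum>j<k. kchar j (f (g ^ (e * t))))" by (rule blocks[symmetric])
  also have "\<dots> = (\<Sum>j<k. D j)" unfolding D_def by (rule sum.swap)
  also have "\<dots> = D 0 + (\<Sum>j\<in>{1..<k}. D j)"
    using k by (simp add: lessThan_atLeast0 sum.atLeast_Suc_lessThan)
  finally have eq: "of_nat e * (of_nat k * (\<Sum>s<m. of_real (weight (e * s)))) = D 0 + (\<Sum>j\<in>{1..<k}. D j)" .
  have D0: "norm (D 0 - of_nat N) \<le> 2 * real e"
  proof -
    define Z where "Z = {t. t < N \<and> f (g ^ (e * t)) = 0}"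
    define h where "h = pcompose [:c, b, a:] (monom 1 e)"
    have ph: "poly h x = f (x ^ e)" for x by (simp add: h_def f_def poly_pcompose poly_monom)
    have dh: "degree h = 2 * e" using a by (simp add: h_def degree_pcompose degree_monom_eq)
    then have h0: "h \<noteq> 0" using e0 by auto
    have "D 0 = (\<Sum>t<N. if t \<in> Z then 0 else 1)"
      unfolding D_def by (rule sum.cong) (auto simp: kchar_def Z_def \<zeta>_def)
    then have "D 0 - of_nat N = (\<Sum>t<N. (if t \<in> Z then 0 else 1) - (1 :: complex))"
      by (simp add: sum_subtractf)
    also have "\<dots> = (\<Sum>t\<in>Z. - 1)"
      by (rule sum.mono_neutral_cong_right) (auto simp: Z_def)
    finally have "norm (D 0 - of_nat N) = real (card Z)" by simp
    also have "card Z = card ((\<lambda>t. g ^ t) ` Z)"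
      by (rule card_image[symmetric], rule inj_on_subset[OF g(3)]) (auto simp: Z_def)
    also have "\<dots> \<le> card {x. poly h x = 0}"
      by (intro card_mono poly_roots_finite h0) (auto simp: Z_def ph mult.commute power_mult)
    also have "\<dots> \<le> 2 * e" using card_poly_roots_bound[OF h0] dh by simp
    finally show ?thesis by simp
  qed
  have Dj: "norm (D j) \<le> 2 * real e * sq" if j: "j \<in> {1..<k}" for j
  proof -
    have nt: "\<exists>x. x \<noteq> 0 \<and> kchar j x \<noteq> 1"
    proof (intro exI conjI)
      show "g \<noteq> 0" by (rule g(1))
      have "[j * dlog g = j * 1] (mod k)" using dlog_cong[of 1] by (intro cong_mult) auto
      then have "\<zeta> (j * dlog g) = \<zeta> j" by (simp add: \<zeta>_eq_iff)
      moreover have "\<zeta> j \<noteq> \<zeta> 0" using j by (auto simp: \<zeta>_eq_iff Cong.cong_def)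
      ultimately show "kchar j g \<noteq> 1" using g(1) by (simp add: kchar_def) (simp add: \<zeta>_def)
    qed
    have "norm (\<Sum>u\<in>UNIV. kchar j (poly [:c, b, a:] (u ^ e))) \<le> real (2 * e - 1) * sq"
      unfolding sq_def using e[unfolded N] norm_kchar kchar_mult
      by (intro weil_bound_quadratic_power a disc nt) (auto simp: kchar_def)
    moreover have "(\<Sum>u\<in>UNIV. kchar j (poly [:c, b, a:] (u ^ e))) = kchar j (f 0) + D j"
      using sum_UNIV_eq[of "\<lambda>u. kchar j (f (u ^ e))"] e0
      by (simp add: f_def D_def power_0_left mult.commute flip: power_mult)
    moreover have "norm (kchar j (f 0)) \<le> 1"
      using norm_kchar[of "f 0" j] by (cases "f 0 = 0") (auto simp: kchar_def)
    moreover have "norm (D j) \<le> norm (kchar j (f 0) + D j) + norm (kchar j (f 0))"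
      by (metis add_diff_cancel_left' norm_triangle_ineq4)
    \<comment> \<open>The + 1 pays for u = 0, which belongs to the sum in Weil's bound but not to
      \<open>D j\<close>; the spare sqrt q in 2 e - 1 absorbs it.\<close>
    ultimately have "norm (D j) \<le> real (2 * e - 1) * sq + 1" by simp
    also have "\<dots> \<le> 2 * real e * sq" using e0 sq1 by (simp add: of_nat_diff algebra_simps)
    finally show ?thesis .
  qed
  define V where "V = (\<Sum>s<m. weight (e * s))"
  have "of_real (real e * (real k * V) - real N) = (D 0 - of_nat N) + (\<Sum>j\<in>{1..<k}. D j)"
    using eq by (simp add: V_def)
  then have "\<bar>real e * (real k * V) - real N\<bar> = norm ((D 0 - of_nat N) + (\<Sum>j\<in>{1..<k}. D j))"
    by (metis norm_of_real)
  also have "\<dots> \<le> norm (D 0 - of_nat N) + norm (\<Sum>j\<in>{1..<k}. D j)" by (rule norm_triangle_ineq)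
  also have "norm (\<Sum>j\<in>{1..<k}. D j) \<le> (\<Sum>j\<in>{1..<k}. norm (D j))" by (rule norm_sum)
  also have "\<dots> \<le> real (card {1..<k}) * (2 * real e * sq)" by (intro sum_bounded_above Dj)
  also have "norm (D 0 - of_nat N) + real (card {1..<k}) * (2 * real e * sq)
    \<le> 2 * real e * sq + real (k - 1) * (2 * real e * sq)"
    using D0 sq1 e0 by (intro add_mono) (auto intro: order_trans)
  also have "\<dots> = real e * (2 * real k * sq)" using k by (simp add: of_nat_diff algebra_simps)
  finally have "\<bar>real e * (real k * V - real N / real e)\<bar> \<le> real e * (2 * real k * sq)"
    using e0 by (simp add: right_diff_distrib)
  then have "\<bar>real k * V - real N / real e\<bar> \<le> 2 * real k * sq"
    using e0 by (simp add: abs_mult)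
  then show ?thesis by (simp add: A V_def sq_def)
qed

lemma primitive_element_g_power:
  assumes "coprime t N"
  shows "primitive_element (g ^ t)"
proof -
  obtain s where s: "[t * s = 1] (mod N)" using cong_solve_coprime_nat[OF assms] by auto
  have "x \<in> range (\<lambda>n :: int. (g ^ t) powi n)" if x: "x \<noteq> 0" for x
  proof -
    have "[t * s * dlog x = 1 * dlog x] (mod N)" by (intro cong_mult s cong_refl)
    then have "g ^ (t * s * dlog x) = g ^ (1 * dlog x)" by (simp only: g_power_eq_iff)
    then have "g ^ (t * s * dlog x) = x" using x by (simp add: g_power_dlog)
    then have "(g ^ t) powi int (s * dlog x) = x"
      by (simp only: power_int_of_nat mult.assoc flip: power_mult)
    then show ?thesis by (metis rangeI)
  qed
  then show ?thesis using g(1) by (auto simp: primitive_element_def)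
qed

end

theorem theorem1p1:
  fixes a b c :: "'a :: {field, finite}"
    and f :: "'a poly"
    and k :: nat
  assumes "k \<ge> 2"
    and "k dvd CARD('a) - 1"
    and "f = [:c, b, a:]"
    and "a \<noteq> 0"
    and "b\<^sup>2 - 4 * a * c \<noteq> 0"
    and "real CARD('a) > max (exp (exp 3)) ((2 * real k) ^ 6)"
  shows "\<exists>g :: 'a. primitive_element g \<and> poly f g \<in> nonzero_kth_powers k"
proof -
  define q where "q = CARD('a)"
  obtain g :: 'a where g: "g \<noteq> 0" "\<And>x. x \<noteq> 0 \<Longrightarrow> \<exists>t<CARD('a) - 1. x = g ^ t"
    "inj_on (\<lambda>t. g ^ t) {..<CARD('a) - 1}" using finite_field_generator[where ?'a = 'a] by blast
  interpret Q: quadratic_kth_power a b c g "CARD('a) - 1" k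
    by unfold_locales (use assms g in auto)
  define B where "B = 2 * real k * sqrt (real q)"
  have q_large: "q > 300000000"
  proof -
    have "real q > 300000000" using assms(6) exp_exp_3_gt by (simp add: q_def)
    then show ?thesis by linarith
  qed
  have "B ^ 3 < real q ^ 2"
  proof -
    have "((2 * real k) ^ 3) ^ 2 < real q" using assms(6) by (simp add: q_def flip: power_mult)
    then have "(2 * real k) ^ 3 < sqrt (real q)" by (rule real_less_rsqrt)
    then have "(2 * real k) ^ 3 * sqrt (real q) ^ 3 < sqrt (real q) * sqrt (real q) ^ 3"
      using q_large by (intro mult_strict_right_mono) auto
    also have "\<dots> = (sqrt (real q) ^ 2) ^ 2" by (simp add: power2_eq_square power3_eq_cube)
    finally show ?thesis by (simp add: B_def power_mult_distrib)
  qed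
  then have "\<exists>t<q - 1. Q.weight t > 0 \<and> coprime t (q - 1)"
    using assms(1) Q.weight_sum_approx[folded q_def B_def]
    by (intro sieve_positive[OF q_large refl, where k = "real k" and B = B])
      (auto simp: B_def Q.weight_def)
  then obtain t where t: "t < q - 1" "Q.weight t > 0" "coprime t (q - 1)" by blast
  have "poly f (g ^ t) \<in> nonzero_kth_powers k"
    using t(2) by (simp add: Q.weight_def Q.f_def assms(3) split: if_splits)
  moreover have "primitive_element (g ^ t)"
    using t(3) by (intro Q.primitive_element_g_power) (simp add: q_def)
  ultimately show ?thesis by blast
qed

end
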